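(* Let $L\in\{1,\infty\}$, let $E$ be a rearrangement-invariant quasi-Banach function space on $(0,L)$ with lower Boyd index $p_E$ and upper Boyd index $q_E$, and let $0<p_0<p_1\le\infty$ and $0<q_0,q_1\le\infty$. Assume that $p_0<p_E$ and that one of the following holds: (i) $q_E<p_1<\infty$ and $\frac1\Theta=\frac1{p_0}-\frac1{p_1}$; or (ii) $p_1=q_1=\infty$, $q_E\le\infty$ and $\Theta=p_0$. Then $$\left(L_{p_0,q_0}(0,L),\,L_{p_1,q_1}(0,L)\right)_{\Theta,p_0;E}=E,$$ i.e. the two spaces coincide as sets and their quasi-norms are equivalent.
   Context: Conventions: $1/\infty=0$, $1/0=\infty$. $\mathfrak M(0,L)$ is the set of complex-valued Lebesgue measurable, a.e. finite functions on $(0,L)$, with a.e. equal functions identified. The non-increasing rearrangement of $f$ is $f^*(t)=\inf\{\lambda>0:\ |\{x\in(0,L):|f(x)|>\lambda\}|\le t\}$, $t>0$. A quasi-norm is a map satisfying the norm axioms except that the triangle inequality is replaced by $\|x+y\|\le C(\|x\|+\|y\|)$ with a constant $C\ge1$. Rearrangement-invariant (r.i.) quasi-Banach function space on $(0,L)$: a quasi-Banach space $E\subset\mathfrak M(0,L)$ for which there is $\rho_E:\mathfrak M(0,L)\to[0,\infty]$ such that (P1) $\rho_E$ is a quasi-norm (possibly taking the value $\infty$); (P2) $|g|\le|f|$ a.e. implies $\rho_E(g)\le\rho_E(f)$; (P3) $0\le f_n\nearrow f$ a.e. implies $\rho_E(f_n)\nearrow\rho_E(f)$; (P4) $\rho_E(\chi_\omega)<\infty$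 for all measurable $\omega\subset(0,L)$ of finite measure; and $\|f\|_E=\rho_E(f^* )$ for all $f\in E$, where $E=\{f\in\mathfrak M(0,L):\rho_E(f^* )<\infty\}$. Boyd indices: for $0<a<\infty$ let $(D_af)(t)=f(at)\chi_{(0,L)}(at)$, $0<t<L$, and let $\|D_a\|$ be its operator norm on $E$. Then $p_E=\sup\{p>0:\exists c>0\ \forall\,0<a<1,\ \|D_a\|\le c\,a^{-1/p}\}$ and $q_E=\inf\{q>0:\exists c>0\ \forall\,a\ge1,\ \|D_a\|\le c\,a^{-1/q}\}$ (with $\inf\emptyset=\infty$). Lorentz spaces: for $0<p,q\le\infty$, $L_{p,q}(0,L)$ is the set of $f\in\mathfrak M(0,L)$ with finite $\|f\|_{p,q}=\big(\int_0^L (t^{1/p}f^*(t))^q\frac{dt}{t}\big)^{1/q}$ if $q<\infty$, and $\|f\|_{p,\infty}=\sup_{0<t<L}t^{1/p}f^*(t)$ if $q=\infty$. Interpolation functor: for a compatible couple $(X_0,X_1)$ of quasi-normed spaces (both continuously embedded in a common Hausdorff topological vector space), Peetre's $K$-functional is $K(t,x;X_0,X_1)=\inf\{\|x_0\|_{X_0}+t\|x_1\|_{X_1}:x=x_0+x_1,\ x_i\in X_i\}$, $t>0$, $x\in X_0+X_1$. For $0<\Theta,r<\infty$, the space $(X_0,X_1)_{\Theta,r;E}$ consists of all $x\in X_0+X_1$ with $\|x\|_{(X_0,X_1)_{\Theta,r;E}}:=\rho_E\big(t^{-1/r}K(t^{1/\Theta},x;X_0,X_1)\big)<\infty$, where the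 argument of $\rho_E$ is regarded as a function of $t\in(0,L)$. *)

theory Defs
  imports "HOL-Analysis.Analysis"
begin

definition intv :: "ennreal \<Rightarrow> real set" where
  "intv L = {t. 0 < t \<and> ennreal t < L}"

text \<open>
  Elements of the function space \<open>\<MM>(0,L)\<close> are represented by functions on the real
  line whose values outside of \<open>(0,L)\<close> are irrelevant; all notions below are invariant
  under changes on null sets of \<open>(0,L)\<close> and outside of \<open>(0,L)\<close>. Complex-valued functions
  are finite everywhere.
\<close>

definition meas_funs :: "ennreal \<Rightarrow> (real \<Rightarrow> complex) set" where
  "meas_funs L = borel_measurable (lebesgue_on (intv L))"

definition ae_eq :: "ennreal \<Rightarrow> (real \<Rightarrow> complex) \<Rightarrow> (real \<Rightarrow> complex) \<Rightarrow> bool" where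
  "ae_eq L f g \<longleftrightarrow> (AE t in lebesgue_on (intv L). f t = g t)"

text \<open>The rearrangement takes the value \<open>\<infinity>\<close> exactly if no level \<open>\<lambda>\<close> is admissible.\<close>

definition rearr :: "ennreal \<Rightarrow> (real \<Rightarrow> complex) \<Rightarrow> real \<Rightarrow> ennreal" where
  "rearr L f t = Inf {ennreal l | l::real. 0 < l \<and>
     emeasure lebesgue {x \<in> intv L. norm (f x) > l} \<le> ennreal t}"

subsection \<open>Quasi-norms and quasi-Banach spaces of measurable functions\<close>

text \<open>The quasi-norm may be infinite on \<open>X\<close>; note that \<open>0 * \<infinity> = 0\<close>.\<close>

definition quasinorm_on ::
  "ennreal \<Rightarrow> (real \<Rightarrow> complex) set \<Rightarrow> ((real \<Rightarrow> complex) \<Rightarrow> ennreal) \<Rightarrow> bool" where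
  "quasinorm_on L X N \<longleftrightarrow>
     (\<forall>f\<in>X. N f = 0 \<longleftrightarrow> ae_eq L f (\<lambda>_. 0)) \<and>
     (\<forall>c. \<forall>f\<in>X. N (\<lambda>t. c * f t) = ennreal (norm c) * N f) \<and>
     (\<exists>C::real. C \<ge> 1 \<and> (\<forall>f\<in>X. \<forall>g\<in>X. N (\<lambda>t. f t + g t) \<le> ennreal C * (N f + N g)))"

definition quasi_Banach_on ::
  "ennreal \<Rightarrow> (real \<Rightarrow> complex) set \<Rightarrow> ((real \<Rightarrow> complex) \<Rightarrow> ennreal) \<Rightarrow> bool" where
  "quasi_Banach_on L X N \<longleftrightarrow>
     X \<subseteq> meas_funs L \<and>
     (\<lambda>_. 0) \<in> X \<and>
     (\<forall>f\<in>X. \<forall>g\<in>X. (\<lambda>t. f t + g t) \<in> X) \<and>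
     (\<forall>c. \<forall>f\<in>X. (\<lambda>t. c * f t) \<in> X) \<and>
     (\<forall>f\<in>X. N f < \<infinity>) \<and>
     quasinorm_on L X N \<and>
     (\<forall>F. (\<forall>n::nat. F n \<in> X) \<and>
          (\<forall>e>0. \<exists>n0. \<forall>m\<ge>n0. \<forall>n\<ge>n0. N (\<lambda>t. F m t - F n t) < ennreal e) \<longrightarrow>
          (\<exists>f\<in>X. (\<lambda>n. N (\<lambda>t. F n t - f t)) \<longlonglongrightarrow> 0))"

subsection \<open>Rearrangement-invariant quasi-Banach function spaces\<close>

text \<open>
  A functional on \<open>\<MM>(0,L)\<close> is evaluated at nonnegative extended real functions that are
  finite a.e.; functions outside of \<open>\<MM>(0,L)\<close> get the value \<open>\<infinity>\<close>.
\<close>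

definition ext_rho ::
  "ennreal \<Rightarrow> ((real \<Rightarrow> complex) \<Rightarrow> ennreal) \<Rightarrow> (real \<Rightarrow> ennreal) \<Rightarrow> ennreal" where
  "ext_rho L \<rho> g = (if g \<in> borel_measurable (lebesgue_on (intv L)) \<and>
       (AE t in lebesgue_on (intv L). g t < \<infinity>)
     then \<rho> (\<lambda>t. complex_of_real (enn2real (g t))) else \<infinity>)"

definition ri_norm ::
  "ennreal \<Rightarrow> ((real \<Rightarrow> complex) \<Rightarrow> ennreal) \<Rightarrow> (real \<Rightarrow> complex) \<Rightarrow> ennreal" where
  "ri_norm L \<rho> f = ext_rho L \<rho> (rearr L f)"

definition ri_space ::
  "ennreal \<Rightarrow> ((real \<Rightarrow> complex) \<Rightarrow> ennreal) \<Rightarrow> (real \<Rightarrow> complex) set" where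
  "ri_space L \<rho> = {f \<in> meas_funs L. ri_norm L \<rho> f < \<infinity>}"

text \<open>
  The functional \<open>\<rho>\<close> determines the space \<open>E\<close> (\<^const>\<open>ri_space\<close>) and its quasi-norm
  (\<^const>\<open>ri_norm\<close>); \<open>\<rho>\<close> itself need not be rearrangement-invariant.
\<close>

definition ri_quasi_Banach_function_space ::
  "ennreal \<Rightarrow> ((real \<Rightarrow> complex) \<Rightarrow> ennreal) \<Rightarrow> bool" where
  "ri_quasi_Banach_function_space L \<rho> \<longleftrightarrow>
     quasi_Banach_on L (ri_space L \<rho>) (ri_norm L \<rho>) \<and>
     quasinorm_on L (meas_funs L) \<rho> \<and>
     (\<forall>f\<in>meas_funs L. \<forall>g\<in>meas_funs L.
        (AE t in lebesgue_on (intv L). norm (g t) \<le> norm (f t)) \<longrightarrow> \<rho> g \<le> \<rho> f) \<and>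
     (\<forall>(u::nat \<Rightarrow> real \<Rightarrow> real) v.
        (\<forall>n. u n \<in> borel_measurable (lebesgue_on (intv L))) \<and>
        v \<in> borel_measurable (lebesgue_on (intv L)) \<and>
        (AE t in lebesgue_on (intv L).
           (\<forall>n. 0 \<le> u n t \<and> u n t \<le> u (Suc n) t) \<and> (\<lambda>n. u n t) \<longlonglongrightarrow> v t) \<longrightarrow>
        incseq (\<lambda>n. \<rho> (\<lambda>t. complex_of_real (u n t))) \<and>
        (\<lambda>n. \<rho> (\<lambda>t. complex_of_real (u n t))) \<longlonglongrightarrow> \<rho> (\<lambda>t. complex_of_real (v t))) \<and>
     (\<forall>\<omega>. \<omega> \<in> sets lebesgue \<and> \<omega> \<subseteq> intv L \<and> emeasure lebesgue \<omega> < \<infinity> \<longrightarrow>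
        \<rho> (indicator \<omega>) < \<infinity>)"

subsection \<open>Boyd indices\<close>

definition dilation :: "ennreal \<Rightarrow> real \<Rightarrow> (real \<Rightarrow> complex) \<Rightarrow> real \<Rightarrow> complex" where
  "dilation L a f t = (if a * t \<in> intv L then f (a * t) else 0)"

definition dilation_norm :: "ennreal \<Rightarrow> ((real \<Rightarrow> complex) \<Rightarrow> ennreal) \<Rightarrow> real \<Rightarrow> ennreal" where
  "dilation_norm L \<rho> a =
     (SUP f\<in>{f \<in> ri_space L \<rho>. ri_norm L \<rho> f \<le> 1}. ri_norm L \<rho> (dilation L a f))"

definition lower_Boyd :: "ennreal \<Rightarrow> ((real \<Rightarrow> complex) \<Rightarrow> ennreal) \<Rightarrow> ennreal" where
  "lower_Boyd L \<rho> = Sup {ennreal p | p::real. 0 < p \<and>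
     (\<exists>c>0. \<forall>a. 0 < a \<and> a < 1 \<longrightarrow> dilation_norm L \<rho> a \<le> ennreal (c * a powr (- (1 / p))))}"

definition upper_Boyd :: "ennreal \<Rightarrow> ((real \<Rightarrow> complex) \<Rightarrow> ennreal) \<Rightarrow> ennreal" where
  "upper_Boyd L \<rho> = Inf {ennreal q | q::real. 0 < q \<and>
     (\<exists>c>0. \<forall>a\<ge>1. dilation_norm L \<rho> a \<le> ennreal (c * a powr (- (1 / q))))}"

subsection \<open>Lorentz spaces\<close>

text \<open>Powers with exponent \<open>a > 0\<close>.\<close>

definition ennpow :: "ennreal \<Rightarrow> real \<Rightarrow> ennreal" where
  "ennpow x a = (if x = \<infinity> then \<infinity> else ennreal (enn2real x powr a))"

text \<open>For \<open>0 < p \<le> \<infinity>\<close>, the real number \<open>1/p\<close> with \<open>1/\<infinity> = 0\<close>.\<close>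

definition recip :: "ennreal \<Rightarrow> real" where
  "recip p = enn2real (1 / p)"

definition lorentz_norm :: "ennreal \<Rightarrow> ennreal \<Rightarrow> ennreal \<Rightarrow> (real \<Rightarrow> complex) \<Rightarrow> ennreal" where
  "lorentz_norm L p q f =
     (if q < \<infinity> then
        ennpow (\<integral>\<^sup>+ t. ennpow (ennreal (t powr recip p) * rearr L f t) (enn2real q) * ennreal (1 / t)
                  \<partial>lebesgue_on (intv L)) (recip q)
      else (SUP t\<in>intv L. ennreal (t powr recip p) * rearr L f t))"

definition lorentz_space :: "ennreal \<Rightarrow> ennreal \<Rightarrow> ennreal \<Rightarrow> (real \<Rightarrow> complex) set" where
  "lorentz_space L p q = {f \<in> meas_funs L. lorentz_norm L p q f < \<infinity>}"

subsection \<open>The interpolation functor\<close>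

text \<open>
  Couples of quasi-normed subspaces \<open>X0, X1\<close> of \<open>\<MM>(0,L)\<close> with quasi-norms \<open>N0, N1\<close>.
\<close>

definition sum_space ::
  "ennreal \<Rightarrow> (real \<Rightarrow> complex) set \<Rightarrow> (real \<Rightarrow> complex) set \<Rightarrow> (real \<Rightarrow> complex) set" where
  "sum_space L X0 X1 =
     {x \<in> meas_funs L. \<exists>x0\<in>X0. \<exists>x1\<in>X1. ae_eq L x (\<lambda>t. x0 t + x1 t)}"

definition K_functional ::
  "ennreal \<Rightarrow> (real \<Rightarrow> complex) set \<Rightarrow> ((real \<Rightarrow> complex) \<Rightarrow> ennreal) \<Rightarrow>
   (real \<Rightarrow> complex) set \<Rightarrow> ((real \<Rightarrow> complex) \<Rightarrow> ennreal) \<Rightarrow>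
   real \<Rightarrow> (real \<Rightarrow> complex) \<Rightarrow> ennreal" where
  "K_functional L X0 N0 X1 N1 t x =
     Inf {N0 x0 + ennreal t * N1 x1 | x0 x1.
       x0 \<in> X0 \<and> x1 \<in> X1 \<and> ae_eq L x (\<lambda>s. x0 s + x1 s)}"

definition interp_norm ::
  "ennreal \<Rightarrow> ((real \<Rightarrow> complex) \<Rightarrow> ennreal) \<Rightarrow> real \<Rightarrow> real \<Rightarrow>
   (real \<Rightarrow> complex) set \<Rightarrow> ((real \<Rightarrow> complex) \<Rightarrow> ennreal) \<Rightarrow>
   (real \<Rightarrow> complex) set \<Rightarrow> ((real \<Rightarrow> complex) \<Rightarrow> ennreal) \<Rightarrow>
   (real \<Rightarrow> complex) \<Rightarrow> ennreal" where
  "interp_norm L \<rho> \<Theta> r X0 N0 X1 N1 x =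
     ext_rho L \<rho> (\<lambda>t. ennreal (t powr (- (1 / r))) * K_functional L X0 N0 X1 N1 (t powr (1 / \<Theta>)) x)"

definition interp_space ::
  "ennreal \<Rightarrow> ((real \<Rightarrow> complex) \<Rightarrow> ennreal) \<Rightarrow> real \<Rightarrow> real \<Rightarrow>
   (real \<Rightarrow> complex) set \<Rightarrow> ((real \<Rightarrow> complex) \<Rightarrow> ennreal) \<Rightarrow>
   (real \<Rightarrow> complex) set \<Rightarrow> ((real \<Rightarrow> complex) \<Rightarrow> ennreal) \<Rightarrow>
   (real \<Rightarrow> complex) set" where
  "interp_space L \<rho> \<Theta> r X0 N0 X1 N1 =
     {x \<in> sum_space L X0 X1. interp_norm L \<rho> \<Theta> r X0 N0 X1 N1 x < \<infinity>}"

definition equiv_quasinorms ::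
  "(real \<Rightarrow> complex) set \<Rightarrow> ((real \<Rightarrow> complex) \<Rightarrow> ennreal) \<Rightarrow>
   ((real \<Rightarrow> complex) \<Rightarrow> ennreal) \<Rightarrow> bool" where
  "equiv_quasinorms X N N' \<longleftrightarrow> (\<exists>c C::real. 0 < c \<and> 0 < C \<and>
     (\<forall>f\<in>X. ennreal c * N f \<le> N' f \<and> N' f \<le> ennreal C * N f))"

end

theory Submission
  imports Defs
begin

text \<open>
  For \<open>f \<in> E\<close> and \<open>t \<in> (0,L)\<close> cut \<open>f\<close> at the height \<open>f\<^sup>*(t)\<close>. The upper part has a
  rearrangement bounded by \<open>f\<^sup>*\<close> and vanishing on \<open>[t,L)\<close>, the lower part one bounded by
  \<open>min (f\<^sup>*(t)) f\<^sup>*\<close>. Comparing \<open>f\<^sup>*\<close> with power weights on the geometric scale \<open>b\<^sup>k t\<close>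
  yields \<open>t\<^bsup>-1/p\<^sub>0\<^esup> K(t\<^bsup>1/\<Theta>\<^esup>, f) \<le> c (\<Sum>\<^sub>k b\<^bsup>-ka\<^esup> f\<^sup>*(b\<^bsup>-k-1\<^esup> t) + \<Sum>\<^sub>k b\<^bsup>kd\<^esup> f\<^sup>*(b\<^sup>k t))\<close>
  for all Lorentz exponents \<open>q\<^sub>0, q\<^sub>1\<close>. By the Boyd index conditions the terms decay
  geometrically in \<open>E\<close>, and for large \<open>b\<close> fast enough to be summed in a quasi-norm.
  Conversely, \<open>f = f\<^sub>0 + f\<^sub>1\<close> implies \<open>f\<^sup>*(2t) \<le> f\<^sub>0\<^sup>*(t) + f\<^sub>1\<^sup>*(t)\<close>, so the weak-type bounds
  for the summands give \<open>f\<^sup>*(2t) \<le> c t\<^bsup>-1/p\<^sub>0\<^esup> K(t\<^bsup>1/\<Theta>\<^esup>, f)\<close>; it remains to dilate by \<open>1/2\<close>.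
\<close>

subsection \<open>Non-increasing rearrangements\<close>

lemma intv_borel: "intv L \<in> sets borel"
  unfolding intv_def by measurable

lemma intv_lebesgue: "intv L \<in> sets lebesgue"
  by (simp add: intv_borel)

text \<open>The endpoint \<open>M\<close> is arbitrary, since the superlevel sets of dilated
  rearrangements are intervals whose endpoint may differ from \<open>L\<close>.\<close>

lemma emeasure_intv: "emeasure lebesgue (intv M) = M"
proof (cases M)
  case (real r)
  then have "intv M = {0<..<r}"
    by (auto simp: intv_def ennreal_less_iff)
  then show ?thesis using real by simp
next
  case top
  have "ennreal (real n) \<le> emeasure lebesgue (intv M)" for n
  proof -
    have "ennreal (real n) = emeasure lebesgue {0<..<real n}" by simp
    also have "\<dots> \<le> emeasure lebesgue (intv M)"
      using top by (intro emeasure_mono intv_lebesgue) (auto simp: intv_def)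
    finally show ?thesis .
  qed
  then have "(SUP n. of_nat n :: ennreal) \<le> emeasure lebesgue (intv M)"
    by (intro SUP_least) (simp add: ennreal_of_nat_eq_real_of_nat)
  then show ?thesis using top
    by (simp add: ennreal_SUP_of_nat_eq_top top_unique)
qed

lemma borel_ennreal_antimono:
  fixes g :: "real \<Rightarrow> ennreal"
  assumes "antimono g"
  shows "g \<in> borel_measurable borel"
proof (rule borel_measurableI_greater)
  fix y
  have "is_interval {x. y < g x}"
    unfolding is_interval_1 using antimonoD[OF assms] by (fastforce intro: less_le_trans)
  then show "{x \<in> space borel. y < g x} \<in> sets borel"
    by (simp add: real_interval_borel_measurable)
qed

lemma borel_ennreal_mono:
  fixes g :: "real \<Rightarrow> ennreal"
  assumes "mono g"
  shows "g \<in> borel_measurable borel"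
proof (rule borel_measurableI_greater)
  fix y
  have "is_interval {x. y < g x}"
    unfolding is_interval_1 using monoD[OF assms] by (fastforce intro: less_le_trans)
  then show "{x \<in> space borel. y < g x} \<in> sets borel"
    by (simp add: real_interval_borel_measurable)
qed

lemma borel_lebesgue_on:
  "g \<in> borel_measurable borel \<Longrightarrow> g \<in> borel_measurable (lebesgue_on S)"
  by (intro measurable_restrict_space1 measurable_completion) simp

section \<open>Rearrangement and distribution function\<close>

lemma level_set_lebesgue:
  assumes "f \<in> meas_funs L"
  shows "{x \<in> intv L. norm (f x) > l} \<in> sets lebesgue"
proof -
  have "{x \<in> space (lebesgue_on (intv L)). norm (f x) > l} \<in> sets (lebesgue_on (intv L))"
    using assms unfolding meas_funs_def by measurable
  then show ?thesis
    using intv_lebesgue by (simp add: space_restrict_space sets_restrict_space_iff)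
qed

text \<open>The distribution function is right-continuous in the level, so a finite infimum in
  \<open>rearr\<close> satisfies the defining inequality itself. The level 0 is included, although
  the definition admits only positive ones.\<close>

lemma rearr_le_iff:
  assumes f: "f \<in> meas_funs L" and l: "0 \<le> l"
  shows "rearr L f t \<le> ennreal l \<longleftrightarrow>
    emeasure lebesgue {x \<in> intv L. norm (f x) > l} \<le> ennreal t"
proof
  let ?E = "\<lambda>l. {x \<in> intv L. norm (f x) > l}"
  have less: "emeasure lebesgue (?E k) \<le> ennreal t" if k: "rearr L f t < ennreal k" for k
  proof -
    obtain j where "0 < j" "emeasure lebesgue (?E j) \<le> ennreal t" "ennreal j < ennreal k"
      using k unfolding rearr_def Inf_less_iff by auto
    moreover have "j \<le> k" using \<open>ennreal j < ennreal k\<close> \<open>0 < j\<close> by (simp add: ennreal_less_iff)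
    then have "emeasure lebesgue (?E k) \<le> emeasure lebesgue (?E j)"
      by (intro emeasure_mono level_set_lebesgue f) auto
    ultimately show ?thesis by order
  qed
  assume le: "rearr L f t \<le> ennreal l"
  \<comment> \<open>Levels above \<open>l\<close> are covered by \<open>less\<close>; the sets
    \<open>?A n\<close> increase to \<open>?E l\<close>, and continuity from below carries the bound
    over to \<open>l\<close>.\<close>
  let ?A = "\<lambda>n. ?E (l + 1 / real (Suc n))"
  have "incseq ?A"
  proof (rule incseq_SucI)
    fix n
    have "1 / real (Suc (Suc n)) \<le> 1 / real (Suc n)" by (simp add: field_simps)
    then show "?A n \<le> ?A (Suc n)" by fastforce
  qed
  then have sup: "(SUP n. emeasure lebesgue (?A n)) = emeasure lebesgue (\<Union>n. ?A n)"
    by (intro SUP_emeasure_incseq) (auto intro!: level_set_lebesgue f)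
  have un: "(\<Union>n. ?A n) = ?E l"
  proof -
    have "\<exists>n. l + 1 / real (Suc n) < y" if "l < y" for y
      using reals_Archimedean[of "y - l"] that by (auto simp: inverse_eq_divide algebra_simps)
    moreover have "l < y" if "l + 1 / real (Suc n) < y" for y n
      using that by (smt (verit) divide_nonneg_nonneg of_nat_0_le_iff)
    ultimately show ?thesis by fast
  qed
  have "(SUP n. emeasure lebesgue (?A n)) \<le> ennreal t"
    using l by (intro SUP_least less le_less_trans[OF le] ennreal_lessI) (auto intro: add_nonneg_pos)
  then show "emeasure lebesgue (?E l) \<le> ennreal t" unfolding sup un .
next
  let ?E = "\<lambda>l. {x \<in> intv L. norm (f x) > l}"
  assume le: "emeasure lebesgue (?E l) \<le> ennreal t"
  show "rearr L f t \<le> ennreal l"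
  proof (rule ennreal_le_epsilon)
    fix e :: real assume "0 < e"
    have "emeasure lebesgue (?E (l + e)) \<le> emeasure lebesgue (?E l)"
      using \<open>0 < e\<close> by (intro emeasure_mono level_set_lebesgue f) auto
    then have "rearr L f t \<le> ennreal (l + e)"
      unfolding rearr_def using le l \<open>0 < e\<close>
      by (intro Inf_lower) (auto intro!: exI[of _ "l + e"])
    then show "rearr L f t \<le> ennreal l + ennreal e"
      using l \<open>0 < e\<close> by simp
  qed
qed

lemma ennreal_eqI:
  assumes "\<And>l. 0 \<le> l \<Longrightarrow> x \<le> ennreal l \<longleftrightarrow> y \<le> ennreal l"
  shows "x = y"
proof (rule antisym)
  show "x \<le> y" using assms by (cases y) auto
  show "y \<le> x" using assms by (cases x) auto
qed

lemma rearr_antimono: "antimono (rearr L f)"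
proof (rule antimonoI)
  fix s t :: real assume "s \<le> t"
  then have "emeasure lebesgue A \<le> ennreal s \<Longrightarrow> emeasure lebesgue A \<le> ennreal t" for A
    using ennreal_leI order_trans by blast
  then show "rearr L f t \<le> rearr L f s"
    unfolding rearr_def by (intro Inf_superset_mono) auto
qed

lemma rearr_le:
  assumes "f \<in> meas_funs L" "g \<in> meas_funs L"
    and "AE x in lebesgue_on (intv L). norm (f x) \<le> norm (g x)"
  shows "rearr L f t \<le> rearr L g t"
proof -
  have "emeasure lebesgue {x \<in> intv L. norm (f x) > l} \<le>
      emeasure lebesgue {x \<in> intv L. norm (g x) > l}" for l
    using assms intv_lebesgue
    by (intro emeasure_mono_AE level_set_lebesgue) (auto simp: AE_restrict_space_iff)
  then show ?thesis
    unfolding rearr_def by (intro Inf_superset_mono) (auto intro: order_trans)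
qed

text \<open>If |f + g| > a + b at a point, then |f| > a or |g| > b there. For a = f^*(t) and b =
  g^*(t) both sets have measure at most t, hence the argument 2t.\<close>

lemma rearr_add_le:
  assumes "f \<in> meas_funs L" "g \<in> meas_funs L" "h \<in> meas_funs L" "0 \<le> t"
    and eq: "ae_eq L h (\<lambda>x. f x + g x)"
  shows "rearr L h (2 * t) \<le> rearr L f t + rearr L g t"
proof (cases "rearr L f t" "rearr L g t" rule: ennreal2_cases)
  case (real_real a b)
  have "emeasure lebesgue {x \<in> intv L. norm (h x) > a + b} \<le>
      emeasure lebesgue ({x \<in> intv L. norm (f x) > a} \<union> {x \<in> intv L. norm (g x) > b})"
  proof (intro emeasure_mono_AE sets.Un level_set_lebesgue assms)
    have "AE x in lebesgue. x \<in> intv L \<longrightarrow> h x = f x + g x"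
      using eq intv_lebesgue by (simp add: ae_eq_def AE_restrict_space_iff)
    then show "AE x in lebesgue. x \<in> {x \<in> intv L. norm (h x) > a + b} \<longrightarrow>
        x \<in> {x \<in> intv L. norm (f x) > a} \<union> {x \<in> intv L. norm (g x) > b}"
    proof eventually_elim
      case (elim x)
      then show ?case using norm_triangle_ineq[of "f x" "g x"] by auto
    qed
  qed
  also have "\<dots> \<le> emeasure lebesgue {x \<in> intv L. norm (f x) > a} +
      emeasure lebesgue {x \<in> intv L. norm (g x) > b}"
    by (intro emeasure_subadditive level_set_lebesgue assms)
  also have "\<dots> \<le> ennreal t + ennreal t"
    using real_real rearr_le_iff[OF assms(1), of a t] rearr_le_iff[OF assms(2), of b t]
    by (intro add_mono) auto
  also have "\<dots> = ennreal (2 * t)"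
    using \<open>0 \<le> t\<close> by (simp flip: ennreal_plus)
  finally show ?thesis
    using rearr_le_iff[OF assms(3), of "a + b" "2 * t"] real_real by simp
qed auto

lemma measurable_rearr_dil:
  "0 < a \<Longrightarrow> (\<lambda>t. rearr L f (a * t)) \<in> borel_measurable (lebesgue_on S)"
  by (intro borel_lebesgue_on borel_ennreal_antimono)
    (use rearr_antimono[of L f] in \<open>auto simp: antimono_def\<close>)

lemma rearr_dil_meas_funs:
  assumes "0 < a"
  shows "(\<lambda>t. complex_of_real (enn2real (rearr L f (a * t)))) \<in> meas_funs L"
  unfolding meas_funs_def using measurable_rearr_dil[OF assms] by measurable

text \<open>Superlevel sets of the dilate are initial intervals of (0,L), and their lengths are read
  off from the distribution function of \<open>f\<close>. Finiteness is assumed because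
  \<open>enn2real\<close> turns the value \<infinity> into 0.\<close>

lemma rearr_rearr_dil:
  assumes f: "f \<in> meas_funs L" and fin: "\<And>s. 0 < s \<Longrightarrow> rearr L f s < \<infinity>"
    and a: "0 < a" and t: "t \<in> intv L"
  shows "rearr L (\<lambda>t. complex_of_real (enn2real (rearr L f (a * t)))) t = rearr L f (a * t)"
proof (rule ennreal_eqI)
  fix l :: real assume l: "0 \<le> l"
  define m where "m = emeasure lebesgue {x \<in> intv L. norm (f x) > l}"
  have lev: "l < norm (complex_of_real (enn2real (rearr L f (a * x)))) \<longleftrightarrow> ennreal x < m / ennreal a"
    if x: "x \<in> intv L" for x
  proof -
    have "0 < a * x" using x a by (auto simp: intv_def)
    then have "rearr L f (a * x) < \<infinity>" by (rule fin)
    then have "l < norm (complex_of_real (enn2real (rearr L f (a * x)))) \<longleftrightarrow> \<not> rearr L f (a * x) \<le> ennreal l"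
      using l by (cases "rearr L f (a * x)") (auto simp: not_le)
    also have "\<dots> \<longleftrightarrow> ennreal (a * x) < m"
      using rearr_le_iff[OF f l, of "a * x"] by (simp add: m_def not_le)
    also have "\<dots> \<longleftrightarrow> ennreal x < m / ennreal a"
      using a x by (cases m) (auto simp: divide_ennreal ennreal_top_divide ennreal_less_iff intv_def field_simps)
    finally show ?thesis .
  qed
  have "{x \<in> intv L. l < norm (complex_of_real (enn2real (rearr L f (a * x))))} =
      intv (min L (m / ennreal a))"
    using lev by (auto simp: intv_def)
  then have em: "emeasure lebesgue {x \<in> intv L. l < norm (complex_of_real (enn2real (rearr L f (a * x))))}
      = min L (m / ennreal a)"
    by (simp add: emeasure_intv)
  \<comment> \<open>The truncation at \<open>L\<close> is invisible at \<open>t\<close>, since t <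
    L.\<close>
  have "min L (m / ennreal a) \<le> ennreal t \<longleftrightarrow> m \<le> ennreal (a * t)"
    using a t by (cases m) (auto simp: divide_ennreal ennreal_top_divide intv_def field_simps min_le_iff_disj top_unique)
  also have "m \<le> ennreal (a * t) \<longleftrightarrow> rearr L f (a * t) \<le> ennreal l"
    unfolding m_def by (rule rearr_le_iff[OF f l, symmetric])
  finally show "rearr L (\<lambda>t. complex_of_real (enn2real (rearr L f (a * t)))) t \<le> ennreal l \<longleftrightarrow>
      rearr L f (a * t) \<le> ennreal l"
    unfolding rearr_le_iff[OF rearr_dil_meas_funs[OF a] l] em .
qed

lemma rearr_eq_0:
  assumes "f \<in> meas_funs L" "L \<le> ennreal t"
  shows "rearr L f t = 0"
proof -
  have "emeasure lebesgue {x \<in> intv L. norm (f x) > 0} \<le> emeasure lebesgue (intv L)"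
    by (intro emeasure_mono intv_lebesgue) auto
  then show ?thesis
    using rearr_le_iff[OF assms(1), of 0 t] assms(2) by (simp add: emeasure_intv)
qed

subsection \<open>Rearrangement-invariant quasi-norms\<close>

lemma ri_rho_mono:
  assumes "ri_quasi_Banach_function_space L \<rho>" "f \<in> meas_funs L" "g \<in> meas_funs L"
    and "AE t in lebesgue_on (intv L). norm (g t) \<le> norm (f t)"
  shows "\<rho> g \<le> \<rho> f"
  using assms unfolding ri_quasi_Banach_function_space_def by blast

lemma quasinorm_on_props:
  assumes "quasinorm_on L X N" "f \<in> X"
  shows quasinorm_on_cmult: "N (\<lambda>t. c * f t) = ennreal (norm c) * N f"
    and quasinorm_on_eq_0_iff: "N f = 0 \<longleftrightarrow> ae_eq L f (\<lambda>_. 0)"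
  using assms unfolding quasinorm_on_def by (elim conjE; simp)+

lemma ri_quasinorm_on:
  assumes "ri_quasi_Banach_function_space L \<rho>"
  shows "quasinorm_on L (meas_funs L) \<rho>" "quasinorm_on L (ri_space L \<rho>) (ri_norm L \<rho>)"
  using assms unfolding ri_quasi_Banach_function_space_def quasi_Banach_on_def by - (elim conjE; assumption)+

lemmas ri_rho_cmult = quasinorm_on_cmult[OF ri_quasinorm_on(1)]
lemmas ri_rho_eq_0_iff = quasinorm_on_eq_0_iff[OF ri_quasinorm_on(1)]
lemmas ri_norm_cmult = quasinorm_on_cmult[OF ri_quasinorm_on(2)]
lemmas ri_norm_eq_0_iff = quasinorm_on_eq_0_iff[OF ri_quasinorm_on(2)]

lemma ri_space_cmult:
  assumes "ri_quasi_Banach_function_space L \<rho>" "f \<in> ri_space L \<rho>"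
  shows "(\<lambda>t. c * f t) \<in> ri_space L \<rho>"
proof -
  have "\<forall>c. \<forall>f\<in>ri_space L \<rho>. (\<lambda>t. c * f t) \<in> ri_space L \<rho>"
    using assms(1) unfolding ri_quasi_Banach_function_space_def quasi_Banach_on_def
    by (elim conjE)
  then show ?thesis using assms(2) by simp
qed

text \<open>Property (P3) as a Fatou property: a common bound for the increasing sequence passes to
  its limit.\<close>

lemma ri_rho_limit:
  fixes u :: "nat \<Rightarrow> real \<Rightarrow> real"
  assumes "ri_quasi_Banach_function_space L \<rho>"
    and "\<And>n. u n \<in> borel_measurable (lebesgue_on (intv L))"
    and "v \<in> borel_measurable (lebesgue_on (intv L))"
    and "AE t in lebesgue_on (intv L).
      (\<forall>n. 0 \<le> u n t \<and> u n t \<le> u (Suc n) t) \<and> (\<lambda>n. u n t) \<longlonglongrightarrow> v t"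
    and le: "\<And>n. \<rho> (\<lambda>t. complex_of_real (u n t)) \<le> B"
  shows "\<rho> (\<lambda>t. complex_of_real (v t)) \<le> B"
proof (rule LIMSEQ_le_const2)
  have "\<forall>(u::nat \<Rightarrow> real \<Rightarrow> real) v.
      (\<forall>n. u n \<in> borel_measurable (lebesgue_on (intv L))) \<and>
      v \<in> borel_measurable (lebesgue_on (intv L)) \<and>
      (AE t in lebesgue_on (intv L).
         (\<forall>n. 0 \<le> u n t \<and> u n t \<le> u (Suc n) t) \<and> (\<lambda>n. u n t) \<longlonglongrightarrow> v t) \<longrightarrow>
      incseq (\<lambda>n. \<rho> (\<lambda>t. complex_of_real (u n t))) \<and>
      (\<lambda>n. \<rho> (\<lambda>t. complex_of_real (u n t))) \<longlonglongrightarrow> \<rho> (\<lambda>t. complex_of_real (v t))"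
    using assms(1) unfolding ri_quasi_Banach_function_space_def by (elim conjE)
  from this[rule_format, OF conjI[OF allI[OF assms(2)] conjI[OF assms(3,4)]]]
  show "(\<lambda>n. \<rho> (\<lambda>t. complex_of_real (u n t))) \<longlonglongrightarrow> \<rho> (\<lambda>t. complex_of_real (v t))"
    by (rule conjunct2)
qed (use le in blast)

section \<open>The functional on functions with values in [0,\<infinity>]\<close>

lemma ext_rho_finiteD:
  assumes "ext_rho L \<rho> g < \<infinity>"
  shows "g \<in> borel_measurable (lebesgue_on (intv L))" "AE t in lebesgue_on (intv L). g t < \<infinity>"
    "ext_rho L \<rho> g = \<rho> (\<lambda>t. complex_of_real (enn2real (g t)))"
  using assms unfolding ext_rho_def by (auto split: if_splits)

lemma ext_rho_eq:
  assumes "g \<in> borel_measurable (lebesgue_on (intv L))" "AE t in lebesgue_on (intv L). g t < \<infinity>"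
  shows "ext_rho L \<rho> g = \<rho> (\<lambda>t. complex_of_real (enn2real (g t)))"
  using assms unfolding ext_rho_def by simp

lemma enn2real_meas_funs:
  assumes [measurable]: "g \<in> borel_measurable (lebesgue_on (intv L))"
  shows "(\<lambda>t. complex_of_real (enn2real (g t))) \<in> meas_funs L"
  unfolding meas_funs_def by measurable

lemma ext_rho_mono:
  assumes ri: "ri_quasi_Banach_function_space L \<rho>"
    and g: "g \<in> borel_measurable (lebesgue_on (intv L))"
    and le: "AE t in lebesgue_on (intv L). g t \<le> h t"
  shows "ext_rho L \<rho> g \<le> ext_rho L \<rho> h"
proof (cases "ext_rho L \<rho> h < \<infinity>")
  case True
  note h = ext_rho_finiteD[OF True]
  from le h(2) have "AE t in lebesgue_on (intv L). g t < \<infinity>"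
    by eventually_elim auto
  moreover from le h(2) have "AE t in lebesgue_on (intv L).
      norm (complex_of_real (enn2real (g t))) \<le> norm (complex_of_real (enn2real (h t)))"
    by eventually_elim (auto intro: enn2real_mono)
  ultimately show ?thesis
    using g h by (auto simp: ext_rho_eq intro!: ri_rho_mono[OF ri] enn2real_meas_funs)
qed (simp add: not_less top_unique)

lemma ext_rho_cong:
  assumes ri: "ri_quasi_Banach_function_space L \<rho>"
    and g: "g \<in> borel_measurable (lebesgue_on (intv L))"
    and eq: "\<And>t. t \<in> intv L \<Longrightarrow> g t = h t"
  shows "ext_rho L \<rho> g = ext_rho L \<rho> h"
proof (rule antisym)
  have "h \<in> borel_measurable (lebesgue_on (intv L))"
    using g by (rule measurable_cong[THEN iffD1, rotated]) (simp add: eq space_restrict_space)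
  then show "ext_rho L \<rho> g \<le> ext_rho L \<rho> h" "ext_rho L \<rho> h \<le> ext_rho L \<rho> g"
    using g eq by (auto intro!: ext_rho_mono[OF ri] AE_I2 simp: space_restrict_space)
qed

lemma ext_rho_zero:
  assumes ri: "ri_quasi_Banach_function_space L \<rho>"
  shows "ext_rho L \<rho> (\<lambda>_. 0) = 0"
  using ri_rho_eq_0_iff[OF ri, of "\<lambda>_. 0"] by (simp add: ext_rho_eq meas_funs_def ae_eq_def)

lemma ext_rho_cmult:
  assumes ri: "ri_quasi_Banach_function_space L \<rho>" and c: "0 < c"
    and g: "g \<in> borel_measurable (lebesgue_on (intv L))"
  shows "ext_rho L \<rho> (\<lambda>t. ennreal c * g t) = ennreal c * ext_rho L \<rho> g"
proof (cases "AE t in lebesgue_on (intv L). g t < \<infinity>")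
  case True
  have "ext_rho L \<rho> (\<lambda>t. ennreal c * g t) =
      \<rho> (\<lambda>t. complex_of_real (enn2real (ennreal c * g t)))"
  proof (rule ext_rho_eq)
    show "AE t in lebesgue_on (intv L). ennreal c * g t < \<infinity>"
      using True by eventually_elim (simp add: ennreal_mult_less_top)
  qed (use g in measurable)
  also have "\<dots> = \<rho> (\<lambda>t. complex_of_real c * complex_of_real (enn2real (g t)))"
    using c by (simp add: enn2real_mult)
  finally show ?thesis
    using c by (simp add: ri_rho_cmult[OF ri] enn2real_meas_funs g ext_rho_eq[OF g True])
next
  case False
  \<comment> \<open>A positive factor does not change where the function is infinite, so both sides
    are \<infinity>.\<close>
  have "g t < \<infinity>" if "ennreal c * g t < \<infinity>" for t
    using that c by (auto simp: ennreal_mult_less_top)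
  then have "\<not> (AE t in lebesgue_on (intv L). ennreal c * g t < \<infinity>)"
    using False by (blast intro: eventually_mono)
  then show ?thesis
    using False c unfolding ext_rho_def by (simp add: ennreal_mult_top)
qed

lemma ext_rho_add:
  assumes ri: "ri_quasi_Banach_function_space L \<rho>"
  obtains C :: real where "C \<ge> 1"
    and "\<And>g h. \<lbrakk>g \<in> borel_measurable (lebesgue_on (intv L)); h \<in> borel_measurable (lebesgue_on (intv L))\<rbrakk>
      \<Longrightarrow> ext_rho L \<rho> (\<lambda>t. g t + h t) \<le> ennreal C * (ext_rho L \<rho> g + ext_rho L \<rho> h)"
proof -
  obtain C :: real where C: "C \<ge> 1" and tri: "\<And>f g. f \<in> meas_funs L \<Longrightarrow> g \<in> meas_funs L \<Longrightarrow>
      \<rho> (\<lambda>t. f t + g t) \<le> ennreal C * (\<rho> f + \<rho> g)"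
    using ri_quasinorm_on(1)[OF ri] unfolding quasinorm_on_def by auto
  have "ext_rho L \<rho> (\<lambda>t. g t + h t) \<le> ennreal C * (ext_rho L \<rho> g + ext_rho L \<rho> h)"
    if [measurable]: "g \<in> borel_measurable (lebesgue_on (intv L))"
      "h \<in> borel_measurable (lebesgue_on (intv L))" for g h
  proof (cases "ext_rho L \<rho> g < \<infinity> \<and> ext_rho L \<rho> h < \<infinity>")
    case True
    then have fin: "AE t in lebesgue_on (intv L). g t < \<infinity>" "AE t in lebesgue_on (intv L). h t < \<infinity>"
      using ext_rho_finiteD by blast+
    then have sum: "AE t in lebesgue_on (intv L). g t + h t < \<infinity>"
      by eventually_elim simp
    have "AE t in lebesgue_on (intv L). norm (complex_of_real (enn2real (g t + h t))) \<le>
        norm (complex_of_real (enn2real (g t)) + complex_of_real (enn2real (h t)))"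
      using fin by eventually_elim (simp add: enn2real_plus flip: of_real_add)
    then have "\<rho> (\<lambda>t. complex_of_real (enn2real (g t + h t))) \<le>
        \<rho> (\<lambda>t. complex_of_real (enn2real (g t)) + complex_of_real (enn2real (h t)))"
      by (intro ri_rho_mono[OF ri]) (auto simp: meas_funs_def)
    also have "\<dots> \<le> ennreal C * (\<rho> (\<lambda>t. complex_of_real (enn2real (g t))) +
        \<rho> (\<lambda>t. complex_of_real (enn2real (h t))))"
      by (intro tri enn2real_meas_funs that)
    finally show ?thesis
      using fin sum by (simp add: ext_rho_eq)
  next
    case False
    then have "ennreal C * (ext_rho L \<rho> g + ext_rho L \<rho> h) = \<infinity>"
      using C by (auto simp: not_less top_unique ennreal_mult_top)
    then show ?thesis by simp
  qed
  then show ?thesis using that C by blast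
qed

text \<open>(P3) presupposes an a.e. finite limit, whereas the supremum might be infinite on a set
  \<open>A\<close>. So \<open>A\<close> is first shown to be null: \<open>N\<close> times its
  indicator is a limit of truncations of the \<open>g n\<close>, which keeps its functional below
  \<open>B\<close> for every \<open>N\<close>. Then (P3) applies to the \<open>g n\<close>
  themselves.\<close>

lemma ext_rho_SUP:
  assumes ri: "ri_quasi_Banach_function_space L \<rho>"
    and g: "\<And>n. g n \<in> borel_measurable (lebesgue_on (intv L))"
    and inc: "\<And>t. incseq (\<lambda>n. g n t)"
    and B: "\<And>n. ext_rho L \<rho> (g n) \<le> B"
  shows "ext_rho L \<rho> (\<lambda>t. SUP n. g n t) \<le> B"
proof (cases "B = \<infinity>")
  case False
  note [measurable] = g
  let ?G = "\<lambda>t. SUP n. g n t"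
  have fin: "ext_rho L \<rho> (g n) < \<infinity>" for n
    using B[of n] False by (simp add: less_top top_unique order.strict_trans1)
  have gfin: "AE t in lebesgue_on (intv L). \<forall>n. g n t < \<infinity>"
    using ext_rho_finiteD(2)[OF fin] by (subst AE_all_countable) blast
  have rho: "\<rho> (\<lambda>t. complex_of_real (enn2real (g n t))) \<le> B" for n
    using B[of n] ext_rho_finiteD(3)[OF fin] by metis
  define A where "A = {t \<in> space (lebesgue_on (intv L)). ?G t = \<infinity>}"
  have A [measurable]: "A \<in> sets (lebesgue_on (intv L))"
    unfolding A_def by measurable
  have chi: "(\<lambda>t. complex_of_real (indicator A t)) \<in> meas_funs L"
    unfolding meas_funs_def by measurable
  have "of_nat N * \<rho> (\<lambda>t. complex_of_real (indicator A t)) \<le> B" for N :: nat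
  proof -
    \<comment> \<open>On \<open>A\<close> the truncation at height \<open>N\<close> eventually
      equals \<open>N\<close>; off \<open>A\<close> it is zero. Being dominated by
      \<open>g n\<close>, it inherits the bound \<open>B\<close>.\<close>
    define u where "u n t = indicator A t * min (real N) (enn2real (g n t))" for n t
    have conv: "AE t in lebesgue_on (intv L).
        (\<forall>n. 0 \<le> u n t \<and> u n t \<le> u (Suc n) t) \<and> (\<lambda>n. u n t) \<longlonglongrightarrow> real N * indicator A t"
      using gfin
    proof eventually_elim
      case (elim t)
      have mono: "enn2real (g m t) \<le> enn2real (g n t)" if "m \<le> n" for m n
        using elim that inc[of t] by (intro enn2real_mono) (auto dest: incseqD)
      have "(\<lambda>n. u n t) \<longlonglongrightarrow> real N * indicator A t"
      proof (cases "t \<in> A")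
        case True
        then have "?G t = top" unfolding A_def by simp
          then have "of_nat N < ?G t" by (simp only: of_nat_less_top)
        then obtain m where "of_nat N < g m t" by (auto simp: less_SUP_iff)
        then have "ennreal (real N) < ennreal (enn2real (g m t))"
          using elim[rule_format, of m] by (simp add: ennreal_of_nat_eq_real_of_nat)
        then have "real N < enn2real (g m t)"
          by (simp add: ennreal_less_iff)
        then have "eventually (\<lambda>n. u n t = real N * indicator A t) sequentially"
          using mono[of m] True
          by (auto simp: eventually_sequentially u_def min_def intro!: exI[of _ m]) (use less_le_trans in fastforce)
        then show ?thesis by (rule tendsto_eventually)
      qed (simp add: u_def)
      moreover have "0 \<le> u n t \<and> u n t \<le> u (Suc n) t" for n
        using mono[of n "Suc n"] by (auto simp: u_def indicator_def min_def)
      ultimately show ?case by blast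
    qed
    have um [measurable]: "u n \<in> borel_measurable (lebesgue_on (intv L))" for n
      unfolding u_def by measurable
    have ub: "\<rho> (\<lambda>t. complex_of_real (u n t)) \<le> B" for n
    proof (rule order_trans[OF ri_rho_mono[OF ri] rho])
      show "AE t in lebesgue_on (intv L).
          norm (complex_of_real (u n t)) \<le> norm (complex_of_real (enn2real (g n t)))"
        by (intro AE_I2) (auto simp: u_def indicator_def)
    qed (unfold meas_funs_def, measurable)
    have "\<rho> (\<lambda>t. complex_of_real (real N * indicator A t)) \<le> B"
      by (rule ri_rho_limit[OF ri um _ conv ub]) measurable
    then show ?thesis
      using ri_rho_cmult[OF ri chi, of "of_real (real N)"] by (simp add: ennreal_of_nat_eq_real_of_nat)
  qed
  \<comment> \<open>Letting \<open>N\<close> grow, \<infinity> times the functional of the indicator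
    is at most the finite \<open>B\<close>, so that functional is 0.\<close>
  then have "(SUP N. of_nat N) * \<rho> (\<lambda>t. complex_of_real (indicator A t)) \<le> B"
    by (subst SUP_mult_right_ennreal) (auto intro: SUP_least)
  then have "\<rho> (\<lambda>t. complex_of_real (indicator A t)) = 0"
    using False by (auto simp: ennreal_SUP_of_nat_eq_top ennreal_top_mult top_unique split: if_splits)
  then have "AE t in lebesgue_on (intv L). t \<notin> A"
    using ri_rho_eq_0_iff[OF ri chi] by (simp add: ae_eq_def indicator_eq_0_iff)
  then have Gfin: "AE t in lebesgue_on (intv L). ?G t < \<infinity>"
    by (rule AE_mp) (intro AE_I2, simp add: A_def less_top[symmetric] del: SUP_eq_top_iff)
  have "AE t in lebesgue_on (intv L). (\<forall>n. 0 \<le> enn2real (g n t) \<and> enn2real (g n t) \<le> enn2real (g (Suc n) t)) \<and>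
      (\<lambda>n. enn2real (g n t)) \<longlonglongrightarrow> enn2real (?G t)"
    using gfin Gfin
  proof eventually_elim
    case (elim t)
    have "(\<lambda>n. g n t) \<longlonglongrightarrow> ?G t" by (rule LIMSEQ_SUP[OF inc])
    then have "(\<lambda>n. enn2real (g n t)) \<longlonglongrightarrow> enn2real (?G t)"
      using elim by (intro tendsto_enn2real) auto
    moreover have "enn2real (g n t) \<le> enn2real (g (Suc n) t)" for n
      using elim inc[of t] by (intro enn2real_mono) (auto dest: incseq_SucD)
    ultimately show ?case by simp
  qed
  then have "\<rho> (\<lambda>t. complex_of_real (enn2real (?G t))) \<le> B"
    by (rule ri_rho_limit[OF ri _ _ _ rho, rotated 2]) measurable
  then show ?thesis
    using Gfin by (simp add: ext_rho_eq)
qed simp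

text \<open>The quasi-triangle inequality repeatedly separates the first summand from the rest, so
  that summand \<open>k\<close> passes through it \<open>Suc k\<close> times. This order attaches
  the high powers to the late terms, which are the small ones in the applications.\<close>

lemma ext_rho_sum:
  assumes ri: "ri_quasi_Banach_function_space L \<rho>"
    and C: "\<And>g h. \<lbrakk>g \<in> borel_measurable (lebesgue_on (intv L)); h \<in> borel_measurable (lebesgue_on (intv L))\<rbrakk>
      \<Longrightarrow> ext_rho L \<rho> (\<lambda>t. g t + h t) \<le> C * (ext_rho L \<rho> g + ext_rho L \<rho> h)"
    and g: "\<And>n. g n \<in> borel_measurable (lebesgue_on (intv L))"
  shows "ext_rho L \<rho> (\<lambda>t. \<Sum>k<n. g k t) \<le> (\<Sum>k<n. C ^ Suc k * ext_rho L \<rho> (g k))"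
  using g
proof (induction n arbitrary: g)
  case 0
  then show ?case by (simp add: ext_rho_zero[OF ri])
next
  case (Suc n)
  note [measurable] = Suc.prems
  have "ext_rho L \<rho> (\<lambda>t. \<Sum>k<Suc n. g k t) = ext_rho L \<rho> (\<lambda>t. g 0 t + (\<Sum>k<n. g (Suc k) t))"
    by (simp only: sum.lessThan_Suc_shift)
  also have "\<dots> \<le> C * (ext_rho L \<rho> (g 0) + ext_rho L \<rho> (\<lambda>t. \<Sum>k<n. g (Suc k) t))"
    by (intro C) measurable
  also have "\<dots> \<le> C * (ext_rho L \<rho> (g 0) + (\<Sum>k<n. C ^ Suc k * ext_rho L \<rho> (g (Suc k))))"
    by (intro mult_left_mono add_left_mono Suc) auto
  also have "\<dots> = (\<Sum>k<Suc n. C ^ Suc k * ext_rho L \<rho> (g k))"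
    by (simp only: sum.lessThan_Suc_shift) (simp add: algebra_simps sum_distrib_left)
  finally show ?case .
qed

text \<open>The factors \<open>C ^ Suc k\<close> replace the Aoki--Rolewicz theorem: they are harmless
  for series whose terms decay geometrically at a sufficiently fast rate.\<close>

lemma ext_rho_suminf:
  assumes ri: "ri_quasi_Banach_function_space L \<rho>"
    and C: "\<And>g h. \<lbrakk>g \<in> borel_measurable (lebesgue_on (intv L)); h \<in> borel_measurable (lebesgue_on (intv L))\<rbrakk>
      \<Longrightarrow> ext_rho L \<rho> (\<lambda>t. g t + h t) \<le> C * (ext_rho L \<rho> g + ext_rho L \<rho> h)"
    and g: "\<And>n. g n \<in> borel_measurable (lebesgue_on (intv L))"
  shows "ext_rho L \<rho> (\<lambda>t. \<Sum>k. g k t) \<le> (\<Sum>k. C ^ Suc k * ext_rho L \<rho> (g k))"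
proof -
  have "ext_rho L \<rho> (\<lambda>t. \<Sum>k<n. g k t) \<le> (\<Sum>k. C ^ Suc k * ext_rho L \<rho> (g k))" for n
    using ext_rho_sum[of L \<rho> C g n, OF ri C g] by (rule order_trans) (auto intro: sum_le_suminf)
  then have "ext_rho L \<rho> (\<lambda>t. SUP n. \<Sum>k<n. g k t) \<le> (\<Sum>k. C ^ Suc k * ext_rho L \<rho> (g k))"
    using g by (intro ext_rho_SUP[OF ri]) (auto intro!: incseq_SucI)
  then show ?thesis by (simp add: suminf_eq_SUP)
qed

section \<open>Dilated rearrangements as elements of E\<close>

lemma rearr_cong:
  assumes "\<And>x. x \<in> intv L \<Longrightarrow> norm (f x) = norm (g x)"
  shows "rearr L f = rearr L g"
proof -
  have "{x \<in> intv L. norm (f x) > l} = {x \<in> intv L. norm (g x) > l}" for l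
    using assms by auto
  then show ?thesis unfolding rearr_def by simp
qed

lemma AE_intv_ex:
  assumes "AE t in lebesgue. t \<in> intv L \<longrightarrow> P t" "0 < L"
  shows "\<exists>t\<in>intv L. P t"
proof (rule ccontr)
  assume "\<not> ?thesis"
  then have "AE t in lebesgue. t \<notin> intv L"
    using assms(1) by (auto elim!: eventually_mono)
  then have "emeasure lebesgue (intv L) = 0"
    using intv_lebesgue by (subst (asm) AE_iff_measurable[of "intv L"]) auto
  then show False
    using assms(2) by (simp add: emeasure_intv)
qed

text \<open>A finite functional gives finite values only almost everywhere. Some such point t
  satisfies a t \<le> s, and monotonicity transfers finiteness to s.\<close>

lemma rearr_finite:
  assumes fin: "ext_rho L \<rho> (\<lambda>t. rearr L f (a * t)) < \<infinity>" and pos: "0 < a" "0 < L" "0 < s"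
  shows "rearr L f s < \<infinity>"
proof -
  have "AE t in lebesgue. t \<in> intv L \<longrightarrow> rearr L f (a * t) < \<infinity>"
    using ext_rho_finiteD(2)[OF fin] intv_lebesgue by (auto simp: AE_restrict_space_iff)
  then have "AE t in lebesgue. t \<in> intv (min L (ennreal (s / a))) \<longrightarrow> rearr L f (a * t) < \<infinity>"
    by eventually_elim (simp add: intv_def)
  then have "\<exists>t\<in>intv (min L (ennreal (s / a))). rearr L f (a * t) < \<infinity>"
    by (rule AE_intv_ex) (use pos in simp)
  then obtain t where t: "t \<in> intv (min L (ennreal (s / a)))" "rearr L f (a * t) < \<infinity>" by blast
  then have "a * t \<le> s" using pos by (auto simp: intv_def ennreal_less_iff field_simps)
  then show ?thesis
    using antimonoD[OF rearr_antimono] t(2) by (meson order.strict_trans1)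
qed

lemma ri_norm_rearr_dil:
  assumes ri: "ri_quasi_Banach_function_space L \<rho>"
    and f: "f \<in> meas_funs L" and fin: "\<And>s. 0 < s \<Longrightarrow> rearr L f s < \<infinity>" and a: "0 < a"
  shows "ri_norm L \<rho> (\<lambda>t. complex_of_real (enn2real (rearr L f (a * t)))) =
    ext_rho L \<rho> (\<lambda>t. rearr L f (a * t))"
  unfolding ri_norm_def using rearr_rearr_dil[OF f fin a]
  by (intro ext_rho_cong[OF ri] borel_lebesgue_on borel_ennreal_antimono rearr_antimono) auto

text \<open>The operator norm is tested on the normalised rearrangement of \<open>f\<close>. Testing
  it on \<open>f\<close> would not do: for finite \<open>L\<close> and a < 1 the dilation discards
  the values of \<open>f\<close> on part of the interval, and these may be the large ones.\<close>

lemma ext_rho_rearr_dil: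
  assumes ri: "ri_quasi_Banach_function_space L \<rho>" and L: "0 < L"
    and f: "f \<in> ri_space L \<rho>" and a: "0 < a"
  shows "ext_rho L \<rho> (\<lambda>t. rearr L f (a * t)) \<le> dilation_norm L \<rho> a * ri_norm L \<rho> f"
proof -
  let ?F = "\<lambda>a t. complex_of_real (enn2real (rearr L f (a * t)))"
  have fm: "f \<in> meas_funs L" using f by (simp add: ri_space_def)
  have Fm: "?F b \<in> meas_funs L" if "0 < b" for b
    using that by (rule rearr_dil_meas_funs)
  have fin: "rearr L f s < \<infinity>" if "0 < s" for s
    using rearr_finite[of L \<rho> f 1] f L that by (simp add: ri_space_def ri_norm_def)
  have normF: "ri_norm L \<rho> (?F b) = ext_rho L \<rho> (\<lambda>t. rearr L f (b * t))" if "0 < b" for b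
    using ri fm fin that by (rule ri_norm_rearr_dil)
  have F1: "ri_norm L \<rho> (?F 1) = ri_norm L \<rho> f"
    using normF[of 1] by (simp add: ri_norm_def)
  have nfin: "ri_norm L \<rho> f < \<infinity>" using f by (simp add: ri_space_def)
  have F1s: "?F 1 \<in> ri_space L \<rho>"
    using F1 nfin Fm[of 1] by (simp add: ri_space_def)
  note hom = ri_norm_cmult[OF ri] ri_space_cmult[OF ri]
  show ?thesis
  proof (cases "ri_norm L \<rho> f = 0")
    \<comment> \<open>The dilation norm may be \<infinity>, but its product with 0 is 0, so the left
      side has to be shown to vanish.\<close>
    case True
    then have "ae_eq L f (\<lambda>_. 0)"
      using ri_norm_eq_0_iff[OF ri f] by simp
    then have "rearr L f t \<le> rearr L (\<lambda>_. 0) t" for t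
      by (intro rearr_le fm) (auto simp: meas_funs_def ae_eq_def)
    moreover have "rearr L (\<lambda>_. 0) t \<le> ennreal 0" for t
      by (subst rearr_le_iff) (auto simp: meas_funs_def)
    ultimately have "rearr L f t = 0" for t by (metis ennreal_0 le_zero_eq)
    then show ?thesis by (simp add: ext_rho_zero[OF ri])
  next
    case False
    then obtain n where n: "ri_norm L \<rho> f = ennreal n" "0 < n"
      using nfin by (cases "ri_norm L \<rho> f") (auto simp: ennreal_eq_0_iff)
    define g where "g = (\<lambda>t. complex_of_real (1 / n) * ?F 1 t)"
    have gs: "g \<in> ri_space L \<rho>" unfolding g_def by (rule hom(2)[OF F1s])
    have "ri_norm L \<rho> g = ennreal (1 / n) * ennreal n"
      unfolding g_def using hom(1)[OF F1s, of "complex_of_real (1 / n)"] n F1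
      by (simp add: norm_divide)
    then have g1: "ri_norm L \<rho> g \<le> 1"
      using n by (simp flip: ennreal_mult)
    have dn: "ri_norm L \<rho> (dilation L a g) \<le> dilation_norm L \<rho> a"
      unfolding dilation_norm_def using gs g1 by (intro SUP_upper) simp
    show ?thesis
    proof (cases "dilation_norm L \<rho> a = \<infinity>")
      case True
      then show ?thesis using False by (simp add: ennreal_top_mult)
    next
      case fin: False
      \<comment> \<open>The cut-off in \<open>dilation\<close> changes nothing, because the
        rearrangement vanishes from \<open>L\<close> on.\<close>
      have dg: "dilation L a g t = complex_of_real (1 / n) * ?F a t" if "t \<in> intv L" for t
      proof (cases "a * t \<in> intv L")
        case False
        then have "L \<le> ennreal (a * t)" using that a by (auto simp: intv_def)
        then show ?thesis
          using False rearr_eq_0[OF fm] by (simp add: dilation_def)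
      qed (simp add: dilation_def g_def)
      have dgm: "dilation L a g \<in> meas_funs L"
        using Fm[OF a] dg unfolding meas_funs_def
        by (subst measurable_cong[where g = "\<lambda>t. complex_of_real (1 / n) * ?F a t"])
          (auto simp: space_restrict_space)
      then have dgs: "dilation L a g \<in> ri_space L \<rho>"
        using dn fin by (auto simp: ri_space_def top.not_eq_extremum intro: le_less_trans)
      have "rearr L (\<lambda>t. complex_of_real n * dilation L a g t) = rearr L (?F a)"
        using dg n by (intro rearr_cong) simp
      then have "ri_norm L \<rho> (?F a) = ri_norm L \<rho> (\<lambda>t. complex_of_real n * dilation L a g t)"
        by (simp add: ri_norm_def)
      also have "\<dots> = ennreal n * ri_norm L \<rho> (dilation L a g)"
        using hom(1)[OF dgs, of "complex_of_real n"] n by simp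
      also have "\<dots> \<le> ennreal n * dilation_norm L \<rho> a"
        using dn by (rule mult_left_mono) simp
      finally show ?thesis
        using n normF[OF a] by (simp add: mult.commute)
    qed
  qed
qed

subsection \<open>Lorentz quasi-norms\<close>

lemma ennpow_ennreal: "0 \<le> x \<Longrightarrow> ennpow (ennreal x) a = ennreal (x powr a)"
  by (simp add: ennpow_def)

lemma ennpow_mono:
  assumes "x \<le> y" "0 \<le> a"
  shows "ennpow x a \<le> ennpow y a"
  using assms by (cases x; cases y) (auto simp: ennpow_def powr_mono2 top_unique)

lemma recip_ennreal: "0 < r \<Longrightarrow> recip (ennreal r) = 1 / r"
  by (simp add: recip_def divide_ennreal flip: ennreal_1)

lemma recip_top [simp]: "recip top = 0"
  by (simp add: recip_def)

lemma recip_nonneg: "0 \<le> recip p"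
  by (simp add: recip_def)

lemma nn_integral_lebesgue_on_intv:
  "(\<integral>\<^sup>+ t. f t \<partial>lebesgue_on (intv L)) = (\<integral>\<^sup>+ t. f t * indicator (intv L) t \<partial>lborel)"
  using intv_lebesgue by (simp add: nn_integral_restrict_space nn_integral_completion)

text \<open>The measure ds/s is dilation invariant, which explains a bound free of t: 1/b is the
  integral of u^(b-1) over (0,1), and 1/c that of u^(-c-1) over (1,\<infinity>).\<close>

lemma nn_integral_powr_weight_le:
  fixes b c t :: real
  assumes "0 < b" "0 < c" "0 < t"
  shows "(\<integral>\<^sup>+ s. ennreal ((if s / t < 1 then (s / t) powr b else (s / t) powr (- c)) / s)
    \<partial>lebesgue_on (intv L)) \<le> ennreal (1 / b + 1 / c)"
proof -
  let ?f = "\<lambda>s. t powr (- b) * s powr (b - 1)" and ?g = "\<lambda>s. t powr c * s powr (- c - 1)"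
  have f: "(?f has_integral t powr (- b) * (t powr (b - 1 + 1) / (b - 1 + 1))) {0..t}"
    using assms by (intro has_integral_mult_right has_integral_powr_from_0) auto
  have g: "(?g has_integral t powr c * (- (t powr (- c - 1 + 1)) / (- c - 1 + 1))) {t..}"
    using assms by (intro has_integral_mult_right has_integral_powr_to_inf) auto
  have "ennreal ((if s / t < 1 then (s / t) powr b else (s / t) powr (- c)) / s) * indicator (intv L) s
      \<le> ennreal (?f s) * indicator {0..t} s + ennreal (?g s) * indicator {t..} s" for s
  proof (cases "s \<in> intv L")
    case True
    then have s: "0 < s" by (simp add: intv_def)
    have "(s / t) powr b / s = ?f s" "(s / t) powr (- c) / s = ?g s"
      using s assms by (simp_all add: powr_divide powr_diff powr_minus field_simps)
    moreover have "s / t < 1 \<longleftrightarrow> s < t" using assms by simp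
    ultimately show ?thesis
      using s by (auto simp: indicator_def)
  qed simp
  then have "(\<integral>\<^sup>+ s. ennreal ((if s / t < 1 then (s / t) powr b else (s / t) powr (- c)) / s)
      \<partial>lebesgue_on (intv L)) \<le>
      (\<integral>\<^sup>+ s. ennreal (?f s) * indicator {0..t} s + ennreal (?g s) * indicator {t..} s \<partial>lborel)"
    unfolding nn_integral_lebesgue_on_intv by (intro nn_integral_mono)
  also have "\<dots> = (\<integral>\<^sup>+ s. ennreal (?f s) * indicator {0..t} s \<partial>lborel) +
      (\<integral>\<^sup>+ s. ennreal (?g s) * indicator {t..} s \<partial>lborel)"
    by (intro nn_integral_add) auto
  also have "(\<integral>\<^sup>+ s. ennreal (?f s) * indicator {0..t} s \<partial>lborel) = ennreal (1 / b)"
    using nn_integral_has_integral_lebesgue'[OF _ f] assms by (simp add: powr_minus field_simps)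
  also have "(\<integral>\<^sup>+ s. ennreal (?g s) * indicator {t..} s \<partial>lborel) = ennreal (1 / c)"
    using nn_integral_has_integral_lebesgue'[OF _ g] assms by (simp add: powr_minus field_simps)
  finally show ?thesis
    using assms by simp
qed

text \<open>A two-power majorant with exponents on either side of 1/p has a finite Lorentz norm for
  every q, of size t^(1/p) by scaling. The second Lorentz parameter thus affects only the constant
  \<open>K\<close>, which is fixed before \<open>f\<close>, \<open>A\<close> and
  \<open>t\<close>.\<close>

lemma lorentz_norm_le_power_weight:
  assumes "0 < q" and a: "a < recip p" and d: "recip p < d"
  obtains K where "0 < K"
    and "\<And>f A t. \<lbrakk>0 \<le> A; 0 < t;
        \<And>s. s \<in> intv L \<Longrightarrow>
          rearr L f s \<le> ennreal (A * (if s / t < 1 then (s / t) powr (- a) else (s / t) powr (- d)))\<rbrakk>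
      \<Longrightarrow> lorentz_norm L p q f \<le> ennreal (K * A * t powr recip p)"
proof -
  define \<alpha> where "\<alpha> = recip p"
  define w where "w u = (if u < 1 then u powr (- a) else u powr (- d))" for u :: real
  define v where "v u = (if u < 1 then u powr (\<alpha> - a) else u powr (- (d - \<alpha>)))" for u :: real
  \<comment> \<open>Scaling pulls out t^(1/p). The remaining \<open>v\<close> has a positive
    exponent below 1 and a negative one above, so it is bounded and its positive powers are
    integrable for ds/s.\<close>
  have v: "s powr \<alpha> * w (s / t) = t powr \<alpha> * v (s / t)" if "0 < s" "0 < t" for s t
    using that by (auto simp: w_def v_def powr_divide powr_diff powr_minus field_simps)
  have v0: "0 \<le> v u" for u by (simp add: v_def)
  have bound: "ennreal (s powr \<alpha>) * rearr L f s \<le> ennreal (A * t powr \<alpha> * v (s / t))"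
    if "0 \<le> A" "0 < t" "s \<in> intv L" "\<And>s. s \<in> intv L \<Longrightarrow> rearr L f s \<le> ennreal (A * w (s / t))"
    for f A t s
  proof -
    have "0 < s" using that(3) by (simp add: intv_def)
    have "ennreal (s powr \<alpha>) * rearr L f s \<le> ennreal (s powr \<alpha>) * ennreal (A * w (s / t))"
      using that by (intro mult_left_mono) auto
    also have "\<dots> = ennreal (A * (s powr \<alpha> * w (s / t)))"
      by (subst ennreal_mult'[symmetric]) (simp_all add: ac_simps)
    finally show ?thesis using v[OF \<open>0 < s\<close> \<open>0 < t\<close>] by (simp add: mult.assoc)
  qed
  show thesis
  proof (cases q)
    case top
    have "lorentz_norm L p q f \<le> ennreal (1 * A * t powr \<alpha>)"
      if *: "0 \<le> A" "0 < t" "\<And>s. s \<in> intv L \<Longrightarrow> rearr L f s \<le> ennreal (A * w (s / t))" for f A t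
    proof -
      have "ennreal (s powr \<alpha>) * rearr L f s \<le> ennreal (1 * A * t powr \<alpha>)" if s: "s \<in> intv L" for s
      proof -
        have "0 < s" using s by (simp add: intv_def)
        have "v u \<le> 1" if "0 < u" for u
          using that a d powr_mono[of "- (d - \<alpha>)" 0 u] by (auto simp: v_def \<alpha>_def intro: powr_le1)
        then have "A * t powr \<alpha> * v (s / t) \<le> A * t powr \<alpha> * 1"
          using * \<open>0 < s\<close> by (intro mult_left_mono) auto
        then show ?thesis
          using bound[OF *(1,2) s *(3)] by (simp add: order_trans ennreal_leI)
      qed
      then show ?thesis
        using top by (auto simp: lorentz_norm_def \<alpha>_def intro: SUP_least)
    qed
    then show ?thesis
      using that[of 1] unfolding w_def \<alpha>_def by simp
  next
    case (real r)
    then have r: "0 < r" "q < \<infinity>" "enn2real q = r" "recip q = 1 / r"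
      using \<open>0 < q\<close> by (auto simp: recip_ennreal)
    \<comment> \<open>The bound of \<open>nn_integral_powr_weight_le\<close> for the r-th power of
      \<open>v\<close>.\<close>
    define J where "J = 1 / ((\<alpha> - a) * r) + 1 / ((d - \<alpha>) * r)"
    have J: "0 < J"
      using a d r by (auto simp: J_def \<alpha>_def intro!: add_pos_pos divide_pos_pos)
    have "lorentz_norm L p q f \<le> ennreal (J powr (1 / r) * A * t powr \<alpha>)"
      if *: "0 \<le> A" "0 < t" "\<And>s. s \<in> intv L \<Longrightarrow> rearr L f s \<le> ennreal (A * w (s / t))" for f A t
    proof -
      define B where "B = A * t powr \<alpha>"
      have B: "0 \<le> B" using * by (simp add: B_def)
      have "(\<integral>\<^sup>+ s. ennpow (ennreal (s powr \<alpha>) * rearr L f s) r * ennreal (1 / s) \<partial>lebesgue_on (intv L))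
          \<le> (\<integral>\<^sup>+ s. ennreal (B powr r) *
              ennreal ((if s / t < 1 then (s / t) powr ((\<alpha> - a) * r) else (s / t) powr (- ((d - \<alpha>) * r))) / s)
            \<partial>lebesgue_on (intv L))"
      proof (intro nn_integral_mono)
        fix s assume "s \<in> space (lebesgue_on (intv L))"
        then have s: "s \<in> intv L" "0 < s" by (auto simp: intv_def space_restrict_space)
        have "ennpow (ennreal (s powr \<alpha>) * rearr L f s) r \<le> ennpow (ennreal (B * v (s / t))) r"
          using bound[OF *(1,2) s(1) *(3)] r by (intro ennpow_mono) (auto simp: B_def)
        also have "\<dots> = ennreal ((B * v (s / t)) powr r)"
          using B v0 by (intro ennpow_ennreal) simp
        also have "(B * v (s / t)) powr r = B powr r *
            (if s / t < 1 then (s / t) powr ((\<alpha> - a) * r) else (s / t) powr (- ((d - \<alpha>) * r)))"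
          using B v0 by (simp add: powr_mult v_def powr_powr del: minus_diff_eq)
        finally have "ennpow (ennreal (s powr \<alpha>) * rearr L f s) r * ennreal (1 / s) \<le>
            ennreal (B powr r * (if s / t < 1 then (s / t) powr ((\<alpha> - a) * r) else (s / t) powr (- ((d - \<alpha>) * r))))
              * ennreal (1 / s)"
          by (rule mult_right_mono) simp
        also have "\<dots> = ennreal (B powr r) *
            ennreal ((if s / t < 1 then (s / t) powr ((\<alpha> - a) * r) else (s / t) powr (- ((d - \<alpha>) * r))) / s)"
          using s by (simp flip: ennreal_mult)
        finally show "ennpow (ennreal (s powr \<alpha>) * rearr L f s) r * ennreal (1 / s) \<le> \<dots>" .
      qed
      also have "\<dots> = ennreal (B powr r) *
          (\<integral>\<^sup>+ s. ennreal ((if s / t < 1 then (s / t) powr ((\<alpha> - a) * r) else (s / t) powr (- ((d - \<alpha>) * r))) / s)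
            \<partial>lebesgue_on (intv L))"
        by (intro nn_integral_cmult borel_lebesgue_on) measurable
      also have "\<dots> \<le> ennreal (B powr r) * ennreal J"
        unfolding J_def using a d r * by (intro mult_left_mono nn_integral_powr_weight_le) (auto simp: \<alpha>_def)
      also have "\<dots> = ennreal (B powr r * J)"
        using J by (simp add: ennreal_mult)
      finally have "lorentz_norm L p q f \<le> ennpow (ennreal (B powr r * J)) (1 / r)"
        unfolding lorentz_norm_def using r by (auto simp: \<alpha>_def intro: ennpow_mono)
      also have "\<dots> = ennreal ((B powr r * J) powr (1 / r))"
        using J by (intro ennpow_ennreal) simp
      also have "(B powr r * J) powr (1 / r) = J powr (1 / r) * A * t powr \<alpha>"
        using B J r *(1) by (simp add: powr_mult powr_powr B_def)
      finally show ?thesis .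
    qed
    moreover have "0 < J powr (1 / r)" using J by simp
    ultimately show ?thesis
      using that[of "J powr (1 / r)"] unfolding w_def \<alpha>_def by simp
  qed
qed

text \<open>The embedding into the weak space with the same p. For finite q the integral is
  restricted to (t/2,t), where f^*(s) \<ge> f^*(t) and s^(1/p) \<ge> (t/2)^(1/p).\<close>

lemma lorentz_norm_ge_weak:
  assumes "0 < q"
  obtains K :: real where "0 < K"
    and "\<And>f t. t \<in> intv L \<Longrightarrow> ennreal (t powr recip p) * rearr L f t \<le> ennreal K * lorentz_norm L p q f"
proof (cases q)
  case top
  show ?thesis
  proof
    show "ennreal (t powr recip p) * rearr L f t \<le> ennreal 1 * lorentz_norm L p q f" if "t \<in> intv L" for f t
      using top that by (auto simp: lorentz_norm_def intro: SUP_upper)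
  qed simp
next
  case (real r)
  then have r: "0 < r" "q < \<infinity>" "enn2real q = r" "recip q = 1 / r"
    using assms by (auto simp: recip_ennreal)
  define \<alpha> where "\<alpha> = recip p"
  have \<alpha>: "0 \<le> \<alpha>" by (simp add: \<alpha>_def recip_nonneg)
  show ?thesis
  proof
    \<comment> \<open>The first factor compares t^(1/p) with (t/2)^(1/p). The second compensates for
      the mass of (t/2,t) under ds/s, which is estimated from below by 1/2.\<close>
    show "0 < 2 powr \<alpha> * 2 powr (1 / r)" by simp
    fix f t assume t: "t \<in> intv L"
    have t0: "0 < t" using t by (simp add: intv_def)
    define X where "X = ennreal ((t / 2) powr \<alpha>) * rearr L f t"
    have "(\<integral>\<^sup>+ s. ennpow X r * ennreal (1 / t) * indicator {t/2<..<t} s \<partial>lborel) \<le>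
        (\<integral>\<^sup>+ s. ennpow (ennreal (s powr \<alpha>) * rearr L f s) r * ennreal (1 / s) \<partial>lebesgue_on (intv L))"
      unfolding nn_integral_lebesgue_on_intv
    proof (intro nn_integral_mono)
      fix s
      show "ennpow X r * ennreal (1 / t) * indicator {t/2<..<t} s \<le>
          ennpow (ennreal (s powr \<alpha>) * rearr L f s) r * ennreal (1 / s) * indicator (intv L) s"
      proof (cases "s \<in> {t/2<..<t}")
        case True
        then have "s \<in> intv L" using t by (auto simp: intv_def intro: le_less_trans[rotated] ennreal_leI)
        moreover have "X \<le> ennreal (s powr \<alpha>) * rearr L f s"
          unfolding X_def using True t0 \<alpha>
          by (intro mult_mono antimonoD[OF rearr_antimono] ennreal_leI powr_mono2) auto
        then have "ennpow X r * ennreal (1 / t) \<le> ennpow (ennreal (s powr \<alpha>) * rearr L f s) r * ennreal (1 / s)"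
          using True t0 r by (intro mult_mono ennpow_mono ennreal_leI) (auto simp: frac_le)
        ultimately show ?thesis using True by simp
      qed simp
    qed
    also have "(\<integral>\<^sup>+ s. ennpow X r * ennreal (1 / t) * indicator {t/2<..<t} s \<partial>lborel) =
        ennpow X r * (ennreal (1 / t) * ennreal (t / 2))"
    proof -
      have "emeasure lborel {t/2<..<t} = ennreal (t / 2)"
        using t0 by simp
      then show ?thesis
        by (subst nn_integral_cmult_indicator) (simp_all add: mult.assoc)
    qed
    also have "ennreal (1 / t) * ennreal (t / 2) = ennreal (1 / 2)"
      using t0 by (simp flip: ennreal_mult)
    finally have "ennpow (ennpow X r * ennreal (1 / 2)) (1 / r) \<le> lorentz_norm L p q f"
      unfolding lorentz_norm_def using r by (auto simp: \<alpha>_def intro: ennpow_mono)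
    moreover have "ennpow (ennpow X r * ennreal (1 / 2)) (1 / r) = X * ennreal (2 powr (- (1 / r)))"
    proof (cases X)
      case (real x)
      then have "ennpow X r * ennreal (1 / 2) = ennreal (x powr r * (1 / 2))"
        by (subst ennreal_mult) (auto simp: ennpow_ennreal)
      then have "ennpow (ennpow X r * ennreal (1 / 2)) (1 / r) = ennreal ((x powr r * (1 / 2)) powr (1 / r))"
        by (simp only:) (rule ennpow_ennreal, simp)
      also have "(x powr r * (1 / 2)) powr (1 / r) = x * 2 powr (- (1 / r))"
        using real r by (simp add: powr_mult powr_powr powr_divide powr_minus_divide)
      finally show ?thesis
        using real by (simp add: ennreal_mult)
    next
      case top
      then show ?thesis by (simp add: ennpow_def ennreal_top_mult)
    qed
    ultimately have le: "X * ennreal (2 powr (- (1 / r))) \<le> lorentz_norm L p q f" by simp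
    have "ennreal (t powr \<alpha>) = ennreal (2 powr \<alpha> * 2 powr (1 / r)) * ennreal ((t / 2) powr \<alpha>) * ennreal (2 powr (- (1 / r)))"
      using t0 by (simp add: powr_divide powr_minus field_simps flip: ennreal_mult)
    then have "ennreal (t powr \<alpha>) * rearr L f t =
        ennreal (2 powr \<alpha> * 2 powr (1 / r)) * (X * ennreal (2 powr (- (1 / r))))"
      by (simp add: X_def ac_simps)
    also have "\<dots> \<le> ennreal (2 powr \<alpha> * 2 powr (1 / r)) * lorentz_norm L p q f"
      using le by (rule mult_left_mono) simp
    finally show "ennreal (t powr recip p) * rearr L f t \<le>
        ennreal (2 powr \<alpha> * 2 powr (1 / r)) * lorentz_norm L p q f"
      by (simp add: \<alpha>_def)
  qed
qed

subsection \<open>Dilation series and the Boyd indices\<close>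

text \<open>Common core of the two dilation series. Term \<open>k\<close> costs the dilation norm
  \<open>D k\<close>, and the quasi-triangle inequality adds \<open>C ^ Suc k\<close>; by
  \<open>geom\<close> the weights outweigh both at ratio 1/2, and the geometric series sums to
  \<open>2 * M\<close>.\<close>

lemma ext_rho_dilation_series_le:
  fixes w D :: "nat \<Rightarrow> real" and C M :: real
  assumes ri: "ri_quasi_Banach_function_space L \<rho>" and L: "0 < L" and C: "0 \<le> C" and M: "0 \<le> M"
    and add: "\<And>g h. \<lbrakk>g \<in> borel_measurable (lebesgue_on (intv L)); h \<in> borel_measurable (lebesgue_on (intv L))\<rbrakk>
      \<Longrightarrow> ext_rho L \<rho> (\<lambda>t. g t + h t) \<le> ennreal C * (ext_rho L \<rho> g + ext_rho L \<rho> h)"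
    and pos: "\<And>k. 0 < \<sigma> k" "\<And>k. 0 < w k" "\<And>k. 0 \<le> D k"
    and dil: "\<And>k. dilation_norm L \<rho> (\<sigma> k) \<le> ennreal (D k)"
    and geom: "\<And>k. C ^ Suc k * (w k * D k) \<le> M * (1 / 2) ^ k"
    and f: "f \<in> ri_space L \<rho>"
  shows "ext_rho L \<rho> (\<lambda>t. \<Sum>k. ennreal (w k) * rearr L f (\<sigma> k * t)) \<le> ennreal (2 * M) * ri_norm L \<rho> f"
proof -
  have meas: "(\<lambda>t. rearr L f (\<sigma> k * t)) \<in> borel_measurable (lebesgue_on (intv L))" for k
    by (intro measurable_rearr_dil pos)
  have "ext_rho L \<rho> (\<lambda>t. \<Sum>k. ennreal (w k) * rearr L f (\<sigma> k * t)) \<le>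
      (\<Sum>k. ennreal C ^ Suc k * ext_rho L \<rho> (\<lambda>t. ennreal (w k) * rearr L f (\<sigma> k * t)))"
    using meas by (intro ext_rho_suminf[OF ri add]) auto
  also have "\<dots> \<le> (\<Sum>k. ennreal (M * (1 / 2) ^ k) * ri_norm L \<rho> f)"
  proof (intro suminf_le summableI)
    fix k
    have "ext_rho L \<rho> (\<lambda>t. ennreal (w k) * rearr L f (\<sigma> k * t)) =
        ennreal (w k) * ext_rho L \<rho> (\<lambda>t. rearr L f (\<sigma> k * t))"
      by (intro ext_rho_cmult[OF ri] pos meas)
    also have "\<dots> \<le> ennreal (w k) * (ennreal (D k) * ri_norm L \<rho> f)"
      by (intro mult_left_mono order_trans[OF ext_rho_rearr_dil[OF ri L f]] mult_right_mono pos dil) auto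
    finally have "ennreal C ^ Suc k * ext_rho L \<rho> (\<lambda>t. ennreal (w k) * rearr L f (\<sigma> k * t)) \<le>
        ennreal C ^ Suc k * (ennreal (w k) * (ennreal (D k) * ri_norm L \<rho> f))"
      by (rule mult_left_mono) simp
    also have "\<dots> = ennreal (C ^ Suc k * (w k * D k)) * ri_norm L \<rho> f"
      using C pos(2,3)[of k] by (simp add: ennreal_mult ennreal_power mult.assoc)
    also have "\<dots> \<le> ennreal (M * (1 / 2) ^ k) * ri_norm L \<rho> f"
      by (intro mult_right_mono ennreal_leI geom) simp
    finally show "ennreal C ^ Suc k * ext_rho L \<rho> (\<lambda>t. ennreal (w k) * rearr L f (\<sigma> k * t)) \<le>
        ennreal (M * (1 / 2) ^ k) * ri_norm L \<rho> f" .
  qed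
  also have "\<dots> = ennreal (2 * M) * ri_norm L \<rho> f"
  proof -
    have "(\<lambda>k. M * (1 / 2) ^ k) sums (M * (1 / (1 - 1 / 2)))"
      by (intro sums_mult geometric_sums) simp
    then have "(\<Sum>k. ennreal (M * (1 / 2) ^ k)) = ennreal (2 * M)"
      using M by (subst suminf_ennreal_eq[where x = "2 * M"]) (auto simp: mult.commute)
    then show ?thesis by simp
  qed
  finally show ?thesis .
qed

text \<open>The base \<open>b\<close> is chosen so large that the decay of the weights beats the
  powers of the constant in the quasi-triangle inequality.\<close>

lemma geometric_base_exists:
  fixes C e :: real
  assumes "1 \<le> C" "0 < e"
  obtains b :: real where "1 < b" "C * b powr (- e) = 1 / 2"
proof
  show "1 < (2 * C) powr (1 / e)"
    using assms by (simp add: gr_one_powr)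
  show "C * ((2 * C) powr (1 / e)) powr (- e) = 1 / 2"
    using assms by (simp add: powr_powr powr_minus field_simps)
qed

text \<open>Dilation by b^(-(k+1)) costs c b^(e(k+1)), and the weight b^(-ak) leaves c b^e
  b^(-(a-e)k), which decays as e < a. The base satisfies C b^(-(a-e)) = 1/2.\<close>

lemma ext_rho_lower_series:
  assumes ri: "ri_quasi_Banach_function_space L \<rho>" and L: "0 < L" and "0 < c" "e < a"
    and dil: "\<And>s. 0 < s \<Longrightarrow> s < 1 \<Longrightarrow> dilation_norm L \<rho> s \<le> ennreal (c * s powr (- e))"
  obtains b M :: real where "1 < b" "0 < M"
    and "\<And>f. f \<in> ri_space L \<rho> \<Longrightarrow> ext_rho L \<rho> (\<lambda>t. \<Sum>k. ennreal (b powr (- (a * real k))) *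
        rearr L f (b powr (- real (Suc k)) * t)) \<le> ennreal M * ri_norm L \<rho> f"
proof -
  obtain C :: real where C: "C \<ge> 1" and
    add: "\<And>g h. \<lbrakk>g \<in> borel_measurable (lebesgue_on (intv L)); h \<in> borel_measurable (lebesgue_on (intv L))\<rbrakk>
      \<Longrightarrow> ext_rho L \<rho> (\<lambda>t. g t + h t) \<le> ennreal C * (ext_rho L \<rho> g + ext_rho L \<rho> h)"
    using ext_rho_add[OF ri] by blast
  obtain b where b: "1 < b" "C * b powr (- (a - e)) = 1 / 2"
    using geometric_base_exists[of C "a - e"] C \<open>e < a\<close> by auto
  define D where "D k = c * (b powr (- real (Suc k))) powr (- e)" for k
  have geom: "C ^ Suc k * (b powr (- (a * real k)) * D k) = (C * c * b powr e) * (1 / 2) ^ k" for k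
  proof -
    have "b powr (- (a * real k)) * D k = c * b powr (- (a * real k) + real (Suc k) * e)"
      by (simp only: D_def powr_powr powr_add) (simp add: algebra_simps)
    also have "- (a * real k) + real (Suc k) * e = e + (- (a - e)) * real k"
      by (simp add: algebra_simps)
    also have "b powr (e + (- (a - e)) * real k) = b powr e * (b powr (- (a - e))) ^ k"
      using b by (simp add: powr_add powr_powr[symmetric] powr_realpow del: powr_powr)
    finally have "C ^ Suc k * (b powr (- (a * real k)) * D k) =
        C * c * b powr e * (C * b powr (- (a - e))) ^ k"
      by (simp add: power_mult_distrib ac_simps)
    then show ?thesis by (simp only: b(2))
  qed
  show ?thesis
  proof (rule that[OF b(1)])
    show "0 < 2 * (C * c * b powr e)" using C b \<open>0 < c\<close> by simp
    fix f assume f: "f \<in> ri_space L \<rho>"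
    show "ext_rho L \<rho> (\<lambda>t. \<Sum>k. ennreal (b powr (- (a * real k))) *
        rearr L f (b powr (- real (Suc k)) * t)) \<le> ennreal (2 * (C * c * b powr e)) * ri_norm L \<rho> f"
    proof (rule ext_rho_dilation_series_le[OF ri L _ _ add _ _ _ _ _ f])
      fix k
      \<comment> \<open>The shift to \<open>Suc k\<close> makes even the first dilation factor
        strictly less than 1, the range in which \<open>dil\<close> is available.\<close>
      have "b powr (- real (Suc k)) < b powr 0"
        using b by (intro powr_less_mono) auto
      then show "dilation_norm L \<rho> (b powr (- real (Suc k))) \<le> ennreal (D k)"
        unfolding D_def using b by (intro dil) auto
      show "C ^ Suc k * (b powr (- (a * real k)) * D k) \<le> (C * c * b powr e) * (1 / 2) ^ k"
        by (rule eq_refl[OF geom])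
      show "0 \<le> D k" using \<open>0 < c\<close> by (simp add: D_def)
    qed (use b C \<open>0 < c\<close> in auto)
  qed
qed

text \<open>The counterpart for arguments beyond t: dilation by b^k contributes c b^(-ek), which
  outweighs the weight b^(dk) as d < e.\<close>

lemma ext_rho_upper_series:
  assumes ri: "ri_quasi_Banach_function_space L \<rho>" and L: "0 < L" and "0 < c" "d < e"
    and dil: "\<And>s. 1 \<le> s \<Longrightarrow> dilation_norm L \<rho> s \<le> ennreal (c * s powr (- e))"
  obtains b M :: real where "1 < b" "0 < M"
    and "\<And>f. f \<in> ri_space L \<rho> \<Longrightarrow> ext_rho L \<rho> (\<lambda>t. \<Sum>k. ennreal (b powr (d * real k)) *
        rearr L f (b powr real k * t)) \<le> ennreal M * ri_norm L \<rho> f"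
proof -
  obtain C :: real where C: "C \<ge> 1" and
    add: "\<And>g h. \<lbrakk>g \<in> borel_measurable (lebesgue_on (intv L)); h \<in> borel_measurable (lebesgue_on (intv L))\<rbrakk>
      \<Longrightarrow> ext_rho L \<rho> (\<lambda>t. g t + h t) \<le> ennreal C * (ext_rho L \<rho> g + ext_rho L \<rho> h)"
    using ext_rho_add[OF ri] by blast
  obtain b where b: "1 < b" "C * b powr (- (e - d)) = 1 / 2"
    using geometric_base_exists[of C "e - d"] C \<open>d < e\<close> by auto
  define D where "D k = c * (b powr real k) powr (- e)" for k
  have geom: "C ^ Suc k * (b powr (d * real k) * D k) = (C * c) * (1 / 2) ^ k" for k
  proof -
    have "b powr (d * real k) * D k = c * b powr (d * real k - real k * e)"
      by (simp add: D_def powr_powr powr_diff powr_minus_divide)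
    also have "d * real k - real k * e = (- (e - d)) * real k"
      by (simp add: algebra_simps)
    also have "b powr ((- (e - d)) * real k) = (b powr (- (e - d))) ^ k"
      using b by (simp add: powr_powr[symmetric] powr_realpow del: powr_powr)
    finally have "C ^ Suc k * (b powr (d * real k) * D k) = C * c * (C * b powr (- (e - d))) ^ k"
      by (simp add: power_mult_distrib ac_simps)
    then show ?thesis by (simp only: b(2))
  qed
  show ?thesis
  proof (rule that[OF b(1)])
    show "0 < 2 * (C * c)" using C \<open>0 < c\<close> by simp
    fix f assume f: "f \<in> ri_space L \<rho>"
    show "ext_rho L \<rho> (\<lambda>t. \<Sum>k. ennreal (b powr (d * real k)) *
        rearr L f (b powr real k * t)) \<le> ennreal (2 * (C * c)) * ri_norm L \<rho> f"
    proof (rule ext_rho_dilation_series_le[OF ri L _ _ add _ _ _ _ _ f])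
      fix k
      show "dilation_norm L \<rho> (b powr real k) \<le> ennreal (D k)"
        unfolding D_def using b by (intro dil) (simp add: ge_one_powr_ge_zero)
      show "C ^ Suc k * (b powr (d * real k) * D k) \<le> (C * c) * (1 / 2) ^ k"
        by (rule eq_refl[OF geom])
      show "0 \<le> D k" using \<open>0 < c\<close> by (simp add: D_def)
    qed (use b C \<open>0 < c\<close> in auto)
  qed
qed

section \<open>Pointwise domination of the rearrangement on a geometric scale\<close>

lemma powr_bracket:
  fixes b y :: real
  assumes "1 < b" "1 \<le> y"
  obtains k :: nat where "b powr real k \<le> y" "y < b powr real (Suc k)"
proof
  have "0 \<le> log b y" using assms by simp
  then have "real (nat \<lfloor>log b y\<rfloor>) \<le> log b y" "log b y < real (Suc (nat \<lfloor>log b y\<rfloor>))"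
    by linarith+
  then show "b powr real (nat \<lfloor>log b y\<rfloor>) \<le> y" "y < b powr real (Suc (nat \<lfloor>log b y\<rfloor>))"
    using assms by (simp_all only: le_log_iff log_less_iff)
qed

lemma ennreal_le_suminf:
  fixes f :: "nat \<Rightarrow> ennreal"
  shows "f k \<le> (\<Sum>k. f k)"
  using sum_le_suminf[of f "{k}"] by simp

text \<open>One term suffices. If b^k \<le> t/s < b^(k+1), then f^*(s) \<le> f^*(b^(-k-1) t) by
  monotonicity, and the weight of this term is b^(-ak) \<ge> (s/t)^a.\<close>

lemma rearr_le_lower_series:
  assumes b: "1 < b" and a: "0 \<le> a" and s: "0 < s" "s < t"
  shows "rearr L f s \<le> ennreal ((s / t) powr (- a)) *
    (\<Sum>k. ennreal (b powr (- (a * real k))) * rearr L f (b powr (- real (Suc k)) * t))"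
proof -
  obtain k where k: "b powr real k \<le> t / s" "t / s < b powr real (Suc k)"
    using powr_bracket[OF b, of "t / s"] s by auto
  have "b powr (- real (Suc k)) * t \<le> s"
    using k(2) s b by (simp only: powr_minus) (simp add: field_simps)
  then have 1: "rearr L f s \<le> rearr L f (b powr (- real (Suc k)) * t)"
    by (rule antimonoD[OF rearr_antimono])
  have "(b powr real k) powr a \<le> (t / s) powr a"
    using k(1) a by (intro powr_mono2) auto
  then have "1 \<le> (s / t) powr (- a) * b powr (- (a * real k))"
    using s b by (simp add: powr_powr powr_minus powr_divide field_simps)
  then have "1 * rearr L f (b powr (- real (Suc k)) * t) \<le>
      ennreal ((s / t) powr (- a) * b powr (- (a * real k))) * rearr L f (b powr (- real (Suc k)) * t)"
    by (intro mult_right_mono) (simp_all flip: ennreal_1)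
  also have "\<dots> = ennreal ((s / t) powr (- a)) *
      (ennreal (b powr (- (a * real k))) * rearr L f (b powr (- real (Suc k)) * t))"
    by (simp add: ennreal_mult mult.assoc)
  also have "\<dots> \<le> ennreal ((s / t) powr (- a)) *
      (\<Sum>k. ennreal (b powr (- (a * real k))) * rearr L f (b powr (- real (Suc k)) * t))"
    by (intro mult_left_mono ennreal_le_suminf) simp
  finally show ?thesis using 1 by simp
qed

text \<open>Again one term suffices, now with b^k \<le> s/t < b^(k+1). The evaluation point b^k t
  lies to the left of s, while (s/t)^d may come close to b^(d(k+1)); hence the loss of b^d.\<close>

lemma rearr_le_upper_series:
  assumes b: "1 < b" and d: "0 \<le> d" and t: "0 < t" "t \<le> s"
  shows "rearr L f s \<le> ennreal (b powr d * (s / t) powr (- d)) *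
    (\<Sum>k. ennreal (b powr (d * real k)) * rearr L f (b powr real k * t))"
proof -
  obtain k where k: "b powr real k \<le> s / t" "s / t < b powr real (Suc k)"
    using powr_bracket[OF b, of "s / t"] t by auto
  have "b powr real k * t \<le> s"
    using k(1) t by (simp add: field_simps)
  then have 1: "rearr L f s \<le> rearr L f (b powr real k * t)"
    by (rule antimonoD[OF rearr_antimono])
  have "(s / t) powr d \<le> (b powr real (Suc k)) powr d"
    using k(2) d t by (intro powr_mono2) auto
  also have "\<dots> = b powr d * b powr (d * real k)"
    using b by (simp add: powr_powr algebra_simps flip: powr_add)
  finally have "1 \<le> (b powr d * (s / t) powr (- d)) * b powr (d * real k)"
    using t b by (simp add: powr_minus powr_divide field_simps)
  then have "1 * rearr L f (b powr real k * t) \<le>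
      ennreal ((b powr d * (s / t) powr (- d)) * b powr (d * real k)) * rearr L f (b powr real k * t)"
    by (intro mult_right_mono) (simp_all flip: ennreal_1)
  also have "\<dots> = ennreal (b powr d * (s / t) powr (- d)) *
      (ennreal (b powr (d * real k)) * rearr L f (b powr real k * t))"
    by (simp add: ennreal_mult mult.assoc)
  also have "\<dots> \<le> ennreal (b powr d * (s / t) powr (- d)) *
      (\<Sum>k. ennreal (b powr (d * real k)) * rearr L f (b powr real k * t))"
    by (intro mult_left_mono ennreal_le_suminf) simp
  finally show ?thesis using 1 by simp
qed

section \<open>Exponents from the Boyd indices\<close>

lemma lower_BoydD:
  assumes "p0 < lower_Boyd L \<rho>" "0 < p0"
  obtains c e :: real where "0 < c" "0 < e" "e < recip p0"
    and "\<And>s. 0 < s \<Longrightarrow> s < 1 \<Longrightarrow> dilation_norm L \<rho> s \<le> ennreal (c * s powr (- e))"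
proof -
  \<comment> \<open>The supremum need not be attained, but the strict inequality yields an
    admissible \<open>p\<close> above \<open>p0\<close>, and e = 1/p leaves a gap below
    1/p0.\<close>
  obtain p c :: real where p: "p0 < ennreal p" "0 < p" "0 < c"
    and dil: "\<forall>a. 0 < a \<and> a < 1 \<longrightarrow> dilation_norm L \<rho> a \<le> ennreal (c * a powr (- (1 / p)))"
    using assms(1) unfolding lower_Boyd_def less_Sup_iff by auto
  obtain r where "p0 = ennreal r" "0 < r" "r < p"
    using p assms(2) by (cases p0) (auto simp: ennreal_less_iff)
  then have "1 / p < recip p0" by (simp add: recip_ennreal frac_less2)
  then show ?thesis using that[of c "1 / p"] p dil by auto
qed

lemma upper_BoydD:
  assumes "upper_Boyd L \<rho> < p1"
  obtains c e :: real where "0 < c" "recip p1 < e"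
    and "\<And>s. 1 \<le> s \<Longrightarrow> dilation_norm L \<rho> s \<le> ennreal (c * s powr (- e))"
proof -
  obtain q c :: real where q: "ennreal q < p1" "0 < q" "0 < c"
    and dil: "\<forall>a\<ge>1. dilation_norm L \<rho> a \<le> ennreal (c * a powr (- (1 / q)))"
    using assms(1) unfolding upper_Boyd_def Inf_less_iff by auto
  have "recip p1 < 1 / q"
  proof (cases p1)
    case (real r)
    then have "q < r" using q by (simp add: ennreal_less_iff)
    then show ?thesis using q real by (simp add: recip_ennreal frac_less2)
  qed (use q recip_top in simp)
  then show ?thesis using that[of c "1 / q"] q dil by auto
qed

text \<open>The set where |f| exceeds the height f^*(t) has measure at most t, so the rearrangement
  of the part \<open>f0\<close> living there vanishes from t on. The remainder \<open>f1\<close> is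
  bounded by that height.\<close>

lemma rearr_split:
  assumes f: "f \<in> meas_funs L" and fin: "rearr L f t < \<infinity>"
  obtains f0 f1 where "f0 \<in> meas_funs L" "f1 \<in> meas_funs L" "\<And>x. f x = f0 x + f1 x"
    and "\<And>s. rearr L f0 s \<le> rearr L f s" "\<And>s. t \<le> s \<Longrightarrow> rearr L f0 s = 0"
    and "\<And>s. rearr L f1 s \<le> rearr L f s" "\<And>s. rearr L f1 s \<le> rearr L f t"
proof -
  obtain l where l: "rearr L f t = ennreal l" "0 \<le> l"
    using fin by (cases "rearr L f t") auto
  define f0 where "f0 x = (if norm (f x) > l then f x else 0)" for x
  define f1 where "f1 x = (if norm (f x) > l then 0 else f x)" for x
  have m [measurable]: "f \<in> borel_measurable (lebesgue_on (intv L))"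
    using f by (simp add: meas_funs_def)
  have m0: "f0 \<in> meas_funs L" and m1: "f1 \<in> meas_funs L"
    unfolding meas_funs_def f0_def f1_def by measurable
  show ?thesis
  proof (rule that[OF m0 m1])
    show "f x = f0 x + f1 x" for x by (simp add: f0_def f1_def)
    show "rearr L f0 s \<le> rearr L f s" for s
      by (intro rearr_le m0 f AE_I2) (simp add: f0_def)
    show "rearr L f1 s \<le> rearr L f s" for s
      by (intro rearr_le m1 f AE_I2) (simp add: f1_def)
    have "{x \<in> intv L. norm (f1 x) > l} = {}"
      using l(2) by (auto simp: f1_def)
    then show "rearr L f1 s \<le> rearr L f t" for s
      unfolding l(1) using rearr_le_iff[OF m1 l(2), of s] by (metis emeasure_empty zero_le)
    have "{x \<in> intv L. norm (f0 x) > 0} = {x \<in> intv L. norm (f x) > l}"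
      using l(2) by (auto simp: f0_def)
    then have "rearr L f0 t \<le> ennreal 0"
      using rearr_le_iff[OF m0 order_refl, of t] rearr_le_iff[OF f l(2), of t] l(1) by simp
    then show "rearr L f0 s = 0" if "t \<le> s" for s
      using antimonoD[OF rearr_antimono that, of L f0] by simp
  qed
qed

text \<open>Cost of the large part \<open>f0\<close> of \<open>rearr_split\<close>, in whose role
  \<open>g\<close> stands. \<open>A f\<close> is the lower dilation series: it is controlled in E
  and supplies the power majorant of \<open>g\<close> to the left of t.\<close>

lemma lorentz_lower_part:
  assumes ri: "ri_quasi_Banach_function_space L \<rho>" and L: "0 < L"
    and p0: "0 < p0" "p0 < lower_Boyd L \<rho>" and q0: "0 < q0"
  obtains K :: real and A where "0 < K" and "\<And>f. A f \<in> borel_measurable (lebesgue_on (intv L))"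
    and "\<And>f. f \<in> ri_space L \<rho> \<Longrightarrow> ext_rho L \<rho> (A f) \<le> ennreal K * ri_norm L \<rho> f"
    and "\<And>f g t. \<lbrakk>t \<in> intv L; \<And>s. rearr L g s \<le> rearr L f s; \<And>s. t \<le> s \<Longrightarrow> rearr L g s = 0\<rbrakk>
      \<Longrightarrow> lorentz_norm L p0 q0 g \<le> ennreal (K * t powr recip p0) * A f t"
proof -
  obtain c e :: real where c: "0 < c" "0 < e" "e < recip p0"
    and dil: "\<And>s. 0 < s \<Longrightarrow> s < 1 \<Longrightarrow> dilation_norm L \<rho> s \<le> ennreal (c * s powr (- e))"
    using lower_BoydD[OF p0(2,1)] by blast
  \<comment> \<open>The midpoint serves two ends: e < a makes the series converge in E, and a < 1/p0
    makes the majorant admissible near 0 in the Lorentz norm.\<close>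
  define a where "a = (e + recip p0) / 2"
  have a: "e < a" "a < recip p0" "0 \<le> a" using c by (simp_all add: a_def)
  obtain b M where b: "1 < b" and M: "0 < M" and series:
    "\<And>f. f \<in> ri_space L \<rho> \<Longrightarrow> ext_rho L \<rho> (\<lambda>t. \<Sum>k. ennreal (b powr (- (a * real k))) *
        rearr L f (b powr (- real (Suc k)) * t)) \<le> ennreal M * ri_norm L \<rho> f"
    using ext_rho_lower_series[OF ri L c(1) a(1) dil] by blast
  \<comment> \<open>The rearrangement of \<open>g\<close> is zero from t on, so any exponent above
    1/p0 will do there.\<close>
  obtain K where K: "0 < K" and lor: "\<And>f A t. \<lbrakk>0 \<le> A; 0 < t; \<And>s. s \<in> intv L \<Longrightarrow>
        rearr L f s \<le> ennreal (A * (if s / t < 1 then (s / t) powr (- a) else (s / t) powr (- (recip p0 + 1))))\<rbrakk>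
      \<Longrightarrow> lorentz_norm L p0 q0 f \<le> ennreal (K * A * t powr recip p0)"
    using lorentz_norm_le_power_weight[OF q0 a(2), of "recip p0 + 1" L] by auto
  define A where "A f t = (\<Sum>k. ennreal (b powr (- (a * real k))) * rearr L f (b powr (- real (Suc k)) * t))" for f t
  show ?thesis
  proof (rule that[of "max K M" A])
    show "0 < max K M" using K by simp
    have [measurable]: "(\<lambda>t. rearr L f (b powr (- real (Suc k)) * t)) \<in> borel_measurable (lebesgue_on (intv L))" for f k
      using b by (intro measurable_rearr_dil) simp
    show "A f \<in> borel_measurable (lebesgue_on (intv L))" for f
      unfolding A_def by measurable
    show "ext_rho L \<rho> (A f) \<le> ennreal (max K M) * ri_norm L \<rho> f" if "f \<in> ri_space L \<rho>" for f
      using series[OF that] unfolding A_def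
      by (rule order_trans) (intro mult_right_mono ennreal_leI, auto)
    fix f g t assume t: "t \<in> intv L" and le: "\<And>s. rearr L g s \<le> rearr L f s"
      and zero: "\<And>s. t \<le> s \<Longrightarrow> rearr L g s = 0"
    have t0: "0 < t" using t by (simp add: intv_def)
    show "lorentz_norm L p0 q0 g \<le> ennreal (max K M * t powr recip p0) * A f t"
    proof (cases "A f t")
      case (real x)
      have "rearr L g s \<le> ennreal (x * (if s / t < 1 then (s / t) powr (- a) else (s / t) powr (- (recip p0 + 1))))"
        if "s \<in> intv L" for s
      proof (cases "s < t")
        case True
        have "0 < s" using that by (simp add: intv_def)
        have "rearr L g s \<le> ennreal ((s / t) powr (- a)) * A f t"
          using rearr_le_lower_series[OF b a(3) \<open>0 < s\<close> True] le order_trans unfolding A_def by blast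
        then show ?thesis
          using real True t0 by (simp add: mult.commute flip: ennreal_mult)
      qed (simp add: zero)
      then have "lorentz_norm L p0 q0 g \<le> ennreal (K * x * t powr recip p0)"
        using real t0 by (intro lor)
      also have "\<dots> \<le> ennreal (max K M * x * t powr recip p0)"
        using real by (intro ennreal_leI mult_right_mono) auto
      also have "\<dots> = ennreal (max K M * t powr recip p0) * A f t"
        using real K by (simp add: ac_simps flip: ennreal_mult)
      finally show ?thesis .
    next
      case top
      then show ?thesis using t0 K by (simp add: ennreal_mult_top)
    qed
  qed
qed

text \<open>Cost of the bounded part \<open>f1\<close> of \<open>rearr_split\<close>. For p1 = q1 =
  \<infinity> the norm is a supremum, at most f^*(t), so that \<open>B f\<close> can be the
  rearrangement itself; otherwise it is the upper dilation series.\<close>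

lemma lorentz_upper_part:
  assumes ri: "ri_quasi_Banach_function_space L \<rho>" and L: "0 < L"
    and p1: "0 < p1" "p1 = \<infinity> \<and> q1 = \<infinity> \<or> upper_Boyd L \<rho> < p1 \<and> p1 < \<infinity>" and q1: "0 < q1"
  obtains K :: real and B where "0 < K" and "\<And>f. B f \<in> borel_measurable (lebesgue_on (intv L))"
    and "\<And>f. f \<in> ri_space L \<rho> \<Longrightarrow> ext_rho L \<rho> (B f) \<le> ennreal K * ri_norm L \<rho> f"
    and "\<And>f g t. \<lbrakk>t \<in> intv L; \<And>s. rearr L g s \<le> rearr L f s; \<And>s. rearr L g s \<le> rearr L f t\<rbrakk>
      \<Longrightarrow> lorentz_norm L p1 q1 g \<le> ennreal (K * t powr recip p1) * B f t"
  using p1(2)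
proof (elim disjE conjE)
  assume "p1 = \<infinity>" "q1 = \<infinity>"
  then have norm: "lorentz_norm L p1 q1 g = (SUP t\<in>intv L. ennreal (t powr 0) * rearr L g t)" for g
    by (simp add: lorentz_norm_def)
  show ?thesis
  proof (rule that[of 1 "rearr L"])
    fix f g t assume t: "t \<in> intv L" and le: "\<And>s. rearr L g s \<le> rearr L f t"
    have "ennreal (s powr 0) * rearr L g s \<le> rearr L f t" if "s \<in> intv L" for s
      using le[of s] that by (simp add: intv_def)
    then show "lorentz_norm L p1 q1 g \<le> ennreal (1 * t powr recip p1) * rearr L f t"
      using t \<open>p1 = \<infinity>\<close> unfolding norm by (auto simp: intv_def intro: SUP_least)
  qed (auto simp: ri_norm_def intro: borel_lebesgue_on borel_ennreal_antimono rearr_antimono)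
next
  assume up: "upper_Boyd L \<rho> < p1" and "p1 < \<infinity>"
  then have p: "0 < recip p1"
    using p1(1) by (cases p1) (auto simp: recip_ennreal)
  obtain c e :: real where c: "0 < c" "recip p1 < e"
    and dil: "\<And>s. 1 \<le> s \<Longrightarrow> dilation_norm L \<rho> s \<le> ennreal (c * s powr (- e))"
    using upper_BoydD[OF up] by blast
  \<comment> \<open>Here d < e gives convergence in E, and d > 1/p1 the decay for large arguments
    that the Lorentz norm requires.\<close>
  define d where "d = (e + recip p1) / 2"
  have d: "d < e" "recip p1 < d" "0 \<le> d" using c p by (simp_all add: d_def)
  obtain b M where b: "1 < b" and M: "0 < M" and series:
    "\<And>f. f \<in> ri_space L \<rho> \<Longrightarrow> ext_rho L \<rho> (\<lambda>t. \<Sum>k. ennreal (b powr (d * real k)) *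
        rearr L f (b powr real k * t)) \<le> ennreal M * ri_norm L \<rho> f"
    using ext_rho_upper_series[OF ri L c(1) d(1) dil] by blast
  \<comment> \<open>To the left of t the constant f^*(t) is the majorant, hence the exponent 0,
    which is admissible as 1/p1 > 0.\<close>
  obtain K where K: "0 < K" and lor: "\<And>f A t. \<lbrakk>0 \<le> A; 0 < t; \<And>s. s \<in> intv L \<Longrightarrow>
        rearr L f s \<le> ennreal (A * (if s / t < 1 then (s / t) powr (- 0) else (s / t) powr (- d)))\<rbrakk>
      \<Longrightarrow> lorentz_norm L p1 q1 f \<le> ennreal (K * A * t powr recip p1)"
    using lorentz_norm_le_power_weight[OF q1 p d(2), of L] by blast
  define B where "B f t = (\<Sum>k. ennreal (b powr (d * real k)) * rearr L f (b powr real k * t))" for f t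
  show ?thesis
  proof (rule that[of "max (K * b powr d) M" B])
    show "0 < max (K * b powr d) M" using M by simp
    have [measurable]: "(\<lambda>t. rearr L f (b powr real k * t)) \<in> borel_measurable (lebesgue_on (intv L))" for f k
      using b by (intro measurable_rearr_dil) simp
    show "B f \<in> borel_measurable (lebesgue_on (intv L))" for f
      unfolding B_def by measurable
    show "ext_rho L \<rho> (B f) \<le> ennreal (max (K * b powr d) M) * ri_norm L \<rho> f" if "f \<in> ri_space L \<rho>" for f
      using series[OF that] unfolding B_def
      by (rule order_trans) (intro mult_right_mono ennreal_leI, auto)
    fix f g t assume t: "t \<in> intv L" and le: "\<And>s. rearr L g s \<le> rearr L f s"
      and top: "\<And>s. rearr L g s \<le> rearr L f t"
    have t0: "0 < t" using t by (simp add: intv_def)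
    \<comment> \<open>The constant f^*(t) has to be measured by the series too: the case s = t of
      the pointwise bound.\<close>
    have tB: "rearr L f t \<le> ennreal (b powr d) * B f t"
      using rearr_le_upper_series[OF b d(3) t0 order_refl, of L f] t0 unfolding B_def by simp
    show "lorentz_norm L p1 q1 g \<le> ennreal (max (K * b powr d) M * t powr recip p1) * B f t"
    proof (cases "B f t")
      case (real x)
      have "rearr L g s \<le> ennreal ((b powr d * x) * (if s / t < 1 then (s / t) powr (- 0) else (s / t) powr (- d)))"
        if "s \<in> intv L" for s
      proof (cases "s < t")
        case True
        have "0 < s" using that by (simp add: intv_def)
        then show ?thesis
          using order_trans[OF top tB] real True t0 by (simp add: ennreal_mult)
      next
        case False
        have "rearr L g s \<le> ennreal (b powr d * (s / t) powr (- d)) * B f t"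
          using rearr_le_upper_series[OF b d(3) t0, of s L f] False le[of s] unfolding B_def by simp
        then show ?thesis
          using real False t0 by (simp add: ac_simps flip: ennreal_mult)
      qed
      then have "lorentz_norm L p1 q1 g \<le> ennreal (K * (b powr d * x) * t powr recip p1)"
        using real t0 by (intro lor) auto
      also have "\<dots> \<le> ennreal (max (K * b powr d) M * x * t powr recip p1)"
        using real by (intro ennreal_leI mult_right_mono) (auto simp: mult.assoc[symmetric] intro: mult_right_mono)
      also have "\<dots> = ennreal (max (K * b powr d) M * t powr recip p1) * B f t"
        using real M K by (simp add: ac_simps le_max_iff_disj flip: ennreal_mult)
      finally show ?thesis .
    next
      case top
      then show ?thesis using t0 M by (simp add: ennreal_mult_top)
    qed
  qed
qed

text \<open>Monotonicity supplies the measurability in t without which \<open>ext_rho\<close>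
  returns \<infinity>.\<close>

lemma mono_K_functional: "mono (\<lambda>t. K_functional L X0 N0 X1 N1 t x)"
proof (rule monoI)
  fix s t :: real assume "s \<le> t"
  show "K_functional L X0 N0 X1 N1 s x \<le> K_functional L X0 N0 X1 N1 t x"
    unfolding K_functional_def
  proof (intro Inf_mono)
    fix y assume "y \<in> {N0 x0 + ennreal t * N1 x1 |x0 x1. x0 \<in> X0 \<and> x1 \<in> X1 \<and> ae_eq L x (\<lambda>s. x0 s + x1 s)}"
    then obtain x0 x1 where "y = N0 x0 + ennreal t * N1 x1" "x0 \<in> X0" "x1 \<in> X1" "ae_eq L x (\<lambda>s. x0 s + x1 s)"
      by blast
    moreover have "N0 x0 + ennreal s * N1 x1 \<le> N0 x0 + ennreal t * N1 x1"
      using \<open>s \<le> t\<close> by (intro add_left_mono mult_right_mono ennreal_leI) auto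
    ultimately show "\<exists>a\<in>{N0 x0 + ennreal s * N1 x1 |x0 x1. x0 \<in> X0 \<and> x1 \<in> X1 \<and> ae_eq L x (\<lambda>s. x0 s + x1 s)}. a \<le> y"
      by blast
  qed
qed

subsection \<open>The interpolation space\<close>

text \<open>The embedding of E into the interpolation space. The pieces of \<open>f\<close> vary
  with t, but measurability in t is required only of the K-functional and of the majorants
  \<open>A f\<close> and \<open>B f\<close>.\<close>

lemma interp_norm_le_ri_norm:
  assumes ri: "ri_quasi_Banach_function_space L \<rho>" and L: "0 < L"
    and p0: "0 < p0" "p0 < lower_Boyd L \<rho>" and q0: "0 < q0"
    and p1: "0 < p1" "p1 = \<infinity> \<and> q1 = \<infinity> \<or> upper_Boyd L \<rho> < p1 \<and> p1 < \<infinity>" and q1: "0 < q1"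
    and \<Theta>: "1 / \<Theta> = recip p0 - recip p1" and r: "1 / r = recip p0"
  obtains M :: real where "0 < M"
    and "\<And>f. f \<in> ri_space L \<rho> \<Longrightarrow> f \<in> sum_space L (lorentz_space L p0 q0) (lorentz_space L p1 q1)"
    and "\<And>f. f \<in> ri_space L \<rho> \<Longrightarrow>
      interp_norm L \<rho> \<Theta> r (lorentz_space L p0 q0) (lorentz_norm L p0 q0)
        (lorentz_space L p1 q1) (lorentz_norm L p1 q1) f \<le> ennreal M * ri_norm L \<rho> f"
proof -
  obtain K0 A where K0: "0 < K0" and Am: "\<And>f. A f \<in> borel_measurable (lebesgue_on (intv L))"
    and A: "\<And>f. f \<in> ri_space L \<rho> \<Longrightarrow> ext_rho L \<rho> (A f) \<le> ennreal K0 * ri_norm L \<rho> f"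
    and A_ge: "\<And>f g t. \<lbrakk>t \<in> intv L; \<And>s. rearr L g s \<le> rearr L f s; \<And>s. t \<le> s \<Longrightarrow> rearr L g s = 0\<rbrakk>
      \<Longrightarrow> lorentz_norm L p0 q0 g \<le> ennreal (K0 * t powr recip p0) * A f t"
    using lorentz_lower_part[OF ri L p0 q0] by blast
  obtain K1 B where K1: "0 < K1" and Bm: "\<And>f. B f \<in> borel_measurable (lebesgue_on (intv L))"
    and B: "\<And>f. f \<in> ri_space L \<rho> \<Longrightarrow> ext_rho L \<rho> (B f) \<le> ennreal K1 * ri_norm L \<rho> f"
    and B_ge: "\<And>f g t. \<lbrakk>t \<in> intv L; \<And>s. rearr L g s \<le> rearr L f s; \<And>s. rearr L g s \<le> rearr L f t\<rbrakk>
      \<Longrightarrow> lorentz_norm L p1 q1 g \<le> ennreal (K1 * t powr recip p1) * B f t"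
    using lorentz_upper_part[OF ri L p1 q1] by blast
  note [measurable] = Am Bm
  obtain C :: real where C: "C \<ge> 1" and
    add: "\<And>g h. \<lbrakk>g \<in> borel_measurable (lebesgue_on (intv L)); h \<in> borel_measurable (lebesgue_on (intv L))\<rbrakk>
      \<Longrightarrow> ext_rho L \<rho> (\<lambda>t. g t + h t) \<le> ennreal C * (ext_rho L \<rho> g + ext_rho L \<rho> h)"
    using ext_rho_add[OF ri] by blast
  let ?X0 = "lorentz_space L p0 q0" and ?N0 = "lorentz_norm L p0 q0"
  let ?X1 = "lorentz_space L p1 q1" and ?N1 = "lorentz_norm L p1 q1"
  have split: "\<exists>f0\<in>?X0. \<exists>f1\<in>?X1. (\<forall>x. f x = f0 x + f1 x) \<and>
      ?N0 f0 \<le> ennreal (K0 * t powr recip p0) * A f t \<and> ?N1 f1 \<le> ennreal (K1 * t powr recip p1) * B f t"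
    if f: "f \<in> ri_space L \<rho>" and t: "t \<in> intv L" and fin: "A f t < \<infinity>" "B f t < \<infinity>" for f t
  proof -
    have fm: "f \<in> meas_funs L" using f by (simp add: ri_space_def)
    have t0: "0 < t" using t by (simp add: intv_def)
    have "rearr L f t < \<infinity>"
      using rearr_finite[of L \<rho> f 1 t] f L t0 by (simp add: ri_space_def ri_norm_def)
    then obtain f0 f1 where m: "f0 \<in> meas_funs L" "f1 \<in> meas_funs L" and eq: "\<And>x. f x = f0 x + f1 x"
      and f0: "\<And>s. rearr L f0 s \<le> rearr L f s" "\<And>s. t \<le> s \<Longrightarrow> rearr L f0 s = 0"
      and f1: "\<And>s. rearr L f1 s \<le> rearr L f s" "\<And>s. rearr L f1 s \<le> rearr L f t"
      using rearr_split[OF fm] by blast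
    have n0: "?N0 f0 \<le> ennreal (K0 * t powr recip p0) * A f t" by (rule A_ge[OF t f0])
    have n1: "?N1 f1 \<le> ennreal (K1 * t powr recip p1) * B f t" by (rule B_ge[OF t f1])
    have "?N0 f0 < \<infinity>" "?N1 f1 < \<infinity>"
      using le_less_trans[OF n0] le_less_trans[OF n1] fin by (auto simp: ennreal_mult_less_top)
    then show ?thesis
      using m eq n0 n1 by (auto simp: lorentz_space_def)
  qed
  define G where "G f t = ennreal (t powr (- (1 / r))) * K_functional L ?X0 ?N0 ?X1 ?N1 (t powr (1 / \<Theta>)) f" for f t
  have G_meas: "G f \<in> borel_measurable (lebesgue_on (intv L))" for f
  proof -
    have [measurable]: "(\<lambda>t. K_functional L ?X0 ?N0 ?X1 ?N1 t f) \<in> borel_measurable borel"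
      by (intro borel_ennreal_mono mono_K_functional)
    show ?thesis unfolding G_def by (intro borel_lebesgue_on) measurable
  qed
  have G_le: "G f t \<le> ennreal K0 * A f t + ennreal K1 * B f t" if f: "f \<in> ri_space L \<rho>" and t: "t \<in> intv L" for f t
  proof (cases "A f t < \<infinity> \<and> B f t < \<infinity>")
    case True
    have t0: "0 < t" using t by (simp add: intv_def)
    obtain f0 f1 where "f0 \<in> ?X0" "f1 \<in> ?X1" and eq: "\<forall>x. f x = f0 x + f1 x"
      and n0: "?N0 f0 \<le> ennreal (K0 * t powr recip p0) * A f t"
      and n1: "?N1 f1 \<le> ennreal (K1 * t powr recip p1) * B f t"
      using split[OF f t] True by blast
    then have "K_functional L ?X0 ?N0 ?X1 ?N1 (t powr (1 / \<Theta>)) f \<le> ?N0 f0 + ennreal (t powr (1 / \<Theta>)) * ?N1 f1"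
      unfolding K_functional_def by (intro Inf_lower) (auto simp: ae_eq_def)
    also have "\<dots> \<le> ennreal (K0 * t powr recip p0) * A f t +
        ennreal (t powr (1 / \<Theta>)) * (ennreal (K1 * t powr recip p1) * B f t)"
      using n0 n1 by (intro add_mono mult_left_mono) auto
    finally have "G f t \<le> ennreal (t powr (- (1 / r))) * (ennreal (K0 * t powr recip p0) * A f t +
        ennreal (t powr (1 / \<Theta>)) * (ennreal (K1 * t powr recip p1) * B f t))"
      unfolding G_def by (rule mult_left_mono) simp
    also have "\<dots> = ennreal (t powr (- (1 / r)) * (K0 * t powr recip p0)) * A f t +
        ennreal (t powr (- (1 / r)) * (t powr (1 / \<Theta>) * (K1 * t powr recip p1))) * B f t"
      using K0 K1 by (simp add: ennreal_mult distrib_left mult.assoc)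
    \<comment> \<open>The relations 1/r = 1/p0 and 1/\<Theta> = 1/p0 - 1/p1 cancel all powers of t,
      here and in the next equation.\<close>
    also have "t powr (- (1 / r)) * (K0 * t powr recip p0) = K0"
      using t0 unfolding r by (simp add: powr_minus)
    also have "t powr (- (1 / r)) * (t powr (1 / \<Theta>) * (K1 * t powr recip p1)) = K1"
      using t0 unfolding r \<Theta> by (simp add: powr_minus powr_diff)
    finally show ?thesis .
  next
    case False
    then have inf: "ennreal K0 * A f t + ennreal K1 * B f t = \<infinity>"
      using K0 K1 by (auto simp: not_less top_unique ennreal_mult_top)
    show ?thesis unfolding inf by simp
  qed
  have AB: "ext_rho L \<rho> (\<lambda>t. ennreal K0 * A f t + ennreal K1 * B f t) \<le>
      ennreal (C * (K0 * K0 + K1 * K1)) * ri_norm L \<rho> f" if f: "f \<in> ri_space L \<rho>" for f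
  proof -
    have "ext_rho L \<rho> (\<lambda>t. ennreal K0 * A f t + ennreal K1 * B f t) \<le>
        ennreal C * (ext_rho L \<rho> (\<lambda>t. ennreal K0 * A f t) + ext_rho L \<rho> (\<lambda>t. ennreal K1 * B f t))"
      by (intro add) measurable
    also have "\<dots> = ennreal C * (ennreal K0 * ext_rho L \<rho> (A f) + ennreal K1 * ext_rho L \<rho> (B f))"
      using K0 K1 by (simp add: ext_rho_cmult[OF ri] Am Bm)
    also have "\<dots> \<le> ennreal C * (ennreal K0 * (ennreal K0 * ri_norm L \<rho> f) + ennreal K1 * (ennreal K1 * ri_norm L \<rho> f))"
      using A[OF f] B[OF f] by (intro mult_left_mono add_mono) auto
    also have "\<dots> = ennreal (C * (K0 * K0 + K1 * K1)) * ri_norm L \<rho> f"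
      using C K0 K1 by (simp add: ennreal_mult distrib_left distrib_right mult.assoc)
    finally show ?thesis .
  qed
  show ?thesis
  proof (rule that[of "C * (K0 * K0 + K1 * K1)"])
    show "0 < C * (K0 * K0 + K1 * K1)"
      using C K0 K1 by (simp add: add_pos_pos)
    fix f assume f: "f \<in> ri_space L \<rho>"
    have nfin: "ri_norm L \<rho> f < \<infinity>" and fm: "f \<in> meas_funs L" using f by (simp_all add: ri_space_def)
    have fin: "ext_rho L \<rho> (\<lambda>t. ennreal K0 * A f t + ennreal K1 * B f t) < \<infinity>"
      using AB[OF f] nfin by (auto simp: ennreal_mult_less_top elim: le_less_trans)
    \<comment> \<open>Membership in the sum space takes a single point where both majorants are
      finite; almost every point is one.\<close>
    have "AE t in lebesgue. t \<in> intv L \<longrightarrow> ennreal K0 * A f t + ennreal K1 * B f t < \<infinity>"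
      using ext_rho_finiteD(2)[OF fin]
      by (rule AE_restrict_space_iff[THEN iffD1, rotated]) (simp add: intv_lebesgue)
    from AE_intv_ex[OF this L]
    obtain t where "t \<in> intv L" "ennreal K0 * A f t + ennreal K1 * B f t < \<infinity>" ..
    moreover from this(2) have "A f t < \<infinity>" "B f t < \<infinity>"
      using K0 K1 by (auto simp: ennreal_mult_less_top)
    ultimately have "\<exists>f0\<in>?X0. \<exists>f1\<in>?X1. \<forall>x. f x = f0 x + f1 x"
      using split[OF f] by blast
    then show "f \<in> sum_space L ?X0 ?X1"
      using fm by (auto simp: sum_space_def ae_eq_def)
    have "ext_rho L \<rho> (G f) \<le> ext_rho L \<rho> (\<lambda>t. ennreal K0 * A f t + ennreal K1 * B f t)"
      using G_le[OF f] by (intro ext_rho_mono[OF ri G_meas] AE_I2) (simp add: space_restrict_space)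
    then show "interp_norm L \<rho> \<Theta> r ?X0 ?N0 ?X1 ?N1 f \<le> ennreal (C * (K0 * K0 + K1 * K1)) * ri_norm L \<rho> f"
      using AB[OF f] unfolding interp_norm_def G_def by (rule order_trans)
  qed
qed

text \<open>The reverse embedding. The weak-type bounds hold for every decomposition, hence for the
  infimum, but control only f^*(2t); the lower Boyd index pays for undoing the factor 2.\<close>

lemma ri_norm_le_interp_norm:
  assumes ri: "ri_quasi_Banach_function_space L \<rho>" and L: "0 < L"
    and p0: "0 < p0" "p0 < lower_Boyd L \<rho>" and q: "0 < q0" "0 < q1"
    and \<Theta>: "1 / \<Theta> = recip p0 - recip p1" and r: "1 / r = recip p0"
  obtains M :: real where "0 < M"
    and "\<And>f. f \<in> interp_space L \<rho> \<Theta> r (lorentz_space L p0 q0) (lorentz_norm L p0 q0)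
        (lorentz_space L p1 q1) (lorentz_norm L p1 q1) \<Longrightarrow>
      ri_norm L \<rho> f \<le> ennreal M * interp_norm L \<rho> \<Theta> r (lorentz_space L p0 q0) (lorentz_norm L p0 q0)
        (lorentz_space L p1 q1) (lorentz_norm L p1 q1) f"
proof -
  let ?X0 = "lorentz_space L p0 q0" and ?N0 = "lorentz_norm L p0 q0"
  let ?X1 = "lorentz_space L p1 q1" and ?N1 = "lorentz_norm L p1 q1"
  obtain c e :: real where c: "0 < c"
    and dil: "\<And>s. 0 < s \<Longrightarrow> s < 1 \<Longrightarrow> dilation_norm L \<rho> s \<le> ennreal (c * s powr (- e))"
    using lower_BoydD[OF p0(2,1)] by metis
  obtain K0 where K0: "0 < K0" and w0: "\<And>f t. t \<in> intv L \<Longrightarrow>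
      ennreal (t powr recip p0) * rearr L f t \<le> ennreal K0 * ?N0 f"
    using lorentz_norm_ge_weak[OF q(1), of L p0] by blast
  obtain K1 where K1: "0 < K1" and w1: "\<And>f t. t \<in> intv L \<Longrightarrow>
      ennreal (t powr recip p1) * rearr L f t \<le> ennreal K1 * ?N1 f"
    using lorentz_norm_ge_weak[OF q(2), of L p1] by blast
  \<comment> \<open>With the larger constant both quotients \<open>K0 / K\<close> and
    \<open>K1 / K\<close> are at most 1, so the cost of the decomposition appears without a
    factor.\<close>
  define K where "K = max K0 K1"
  have K: "0 < K" using K0 by (simp add: K_def)
  define G where "G f t = ennreal (t powr (- (1 / r))) * K_functional L ?X0 ?N0 ?X1 ?N1 (t powr (1 / \<Theta>)) f" for f t
  have GN: "interp_norm L \<rho> \<Theta> r ?X0 ?N0 ?X1 ?N1 f = ext_rho L \<rho> (G f)" for f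
    unfolding interp_norm_def G_def ..
  have le: "rearr L f (2 * t) \<le> ennreal K * G f t" if fm: "f \<in> meas_funs L" and t: "t \<in> intv L" for f t
  proof -
    have t0: "0 < t" using t by (simp add: intv_def)
    have "ennreal (t powr recip p0 / K) * rearr L f (2 * t) \<le>
        K_functional L ?X0 ?N0 ?X1 ?N1 (t powr (1 / \<Theta>)) f"
      unfolding K_functional_def
    proof (rule Inf_greatest, elim CollectE exE conjE)
      fix y f0 f1 assume y: "y = ?N0 f0 + ennreal (t powr (1 / \<Theta>)) * ?N1 f1"
        and f01: "f0 \<in> ?X0" "f1 \<in> ?X1" and eq: "ae_eq L f (\<lambda>s. f0 s + f1 s)"
      have "rearr L f (2 * t) \<le> rearr L f0 t + rearr L f1 t"
        using f01 fm t0 eq by (intro rearr_add_le) (auto simp: lorentz_space_def)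
      then have "ennreal (t powr recip p0 / K) * rearr L f (2 * t) \<le>
          ennreal (t powr recip p0 / K) * (rearr L f0 t + rearr L f1 t)"
        by (rule mult_left_mono) simp
      \<comment> \<open>On the second summand t^(1/p0) is split into t^(1/\<Theta>) and t^(1/p1), to
        match the weight in the K-functional.\<close>
      also have "\<dots> = ennreal (1 / K) * (ennreal (t powr recip p0) * rearr L f0 t) +
          ennreal (t powr (1 / \<Theta>) / K) * (ennreal (t powr recip p1) * rearr L f1 t)"
      proof -
        have "t powr recip p0 / K = 1 / K * t powr recip p0"
          "t powr recip p0 / K = t powr (1 / \<Theta>) / K * t powr recip p1"
          using t0 unfolding \<Theta> by (simp_all add: powr_diff)
        then have "ennreal (t powr recip p0 / K) = ennreal (1 / K) * ennreal (t powr recip p0)"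
          "ennreal (t powr recip p0 / K) = ennreal (t powr (1 / \<Theta>) / K) * ennreal (t powr recip p1)"
          using K by (metis ennreal_mult'' powr_ge_zero)+
        then show ?thesis by (metis distrib_left mult.assoc)
      qed
      also have "\<dots> \<le> ennreal (1 / K) * (ennreal K0 * ?N0 f0) +
          ennreal (t powr (1 / \<Theta>) / K) * (ennreal K1 * ?N1 f1)"
        by (intro add_mono mult_left_mono w0 w1 t) auto
      also have "\<dots> = ennreal (K0 / K) * ?N0 f0 + ennreal (t powr (1 / \<Theta>) * (K1 / K)) * ?N1 f1"
        using K K0 K1 by (simp add: mult.assoc[symmetric] flip: ennreal_mult)
      also have "\<dots> \<le> 1 * ?N0 f0 + ennreal (t powr (1 / \<Theta>)) * ?N1 f1"
      proof (intro add_mono mult_right_mono)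
        have "K0 / K \<le> 1" "K1 / K \<le> 1"
          using K by (simp_all add: K_def)
        then show "ennreal (K0 / K) \<le> 1" "ennreal (t powr (1 / \<Theta>) * (K1 / K)) \<le> ennreal (t powr (1 / \<Theta>))"
          using mult_left_le[of "K1 / K" "t powr (1 / \<Theta>)"] by (simp_all add: ennreal_leI)
      qed auto
      finally show "ennreal (t powr recip p0 / K) * rearr L f (2 * t) \<le> y" by (simp add: y)
    qed
    then have "ennreal (K * t powr (- recip p0)) * (ennreal (t powr recip p0 / K) * rearr L f (2 * t)) \<le>
        ennreal (K * t powr (- recip p0)) * K_functional L ?X0 ?N0 ?X1 ?N1 (t powr (1 / \<Theta>)) f"
      by (rule mult_left_mono) simp
    also have "ennreal (K * t powr (- recip p0)) * (ennreal (t powr recip p0 / K) * rearr L f (2 * t)) =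
        rearr L f (2 * t)"
      using K t0 by (simp add: mult.assoc[symmetric] powr_minus flip: ennreal_mult)
    also have "ennreal (K * t powr (- recip p0)) * K_functional L ?X0 ?N0 ?X1 ?N1 (t powr (1 / \<Theta>)) f =
        ennreal K * G f t"
      using K by (simp add: G_def r ennreal_mult mult.assoc)
    finally show ?thesis .
  qed
  show ?thesis
  \<comment> \<open>The factor c (1/2)^(-e) bounds the norm of the dilation by 1/2, and
    \<open>K\<close> stems from \<open>le\<close>.\<close>
  proof (rule that[of "c * (1 / 2) powr (- e) * K"])
    show "0 < c * (1 / 2) powr (- e) * K" using c K by simp
    fix f assume "f \<in> interp_space L \<rho> \<Theta> r ?X0 ?N0 ?X1 ?N1"
    then have fm: "f \<in> meas_funs L" and fin: "ext_rho L \<rho> (G f) < \<infinity>"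
      by (auto simp: interp_space_def sum_space_def GN)
    have "ext_rho L \<rho> (\<lambda>t. rearr L f (2 * t)) \<le> ext_rho L \<rho> (\<lambda>t. ennreal K * G f t)"
      using le[OF fm] by (intro ext_rho_mono[OF ri] measurable_rearr_dil AE_I2) (auto simp: space_restrict_space)
    also have "\<dots> = ennreal K * ext_rho L \<rho> (G f)"
      using ext_rho_finiteD(1)[OF fin] K by (intro ext_rho_cmult[OF ri])
    finally have 1: "ext_rho L \<rho> (\<lambda>t. rearr L f (2 * t)) \<le> ennreal K * ext_rho L \<rho> (G f)" .
    then have 2: "ext_rho L \<rho> (\<lambda>t. rearr L f (2 * t)) < \<infinity>"
      using fin by (auto simp: ennreal_mult_less_top elim: le_less_trans)
    have rfin: "rearr L f s < \<infinity>" if "0 < s" for s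
      by (rule rearr_finite[OF 2 _ L that]) simp
    \<comment> \<open>Membership of \<open>f\<close> in E is not yet known, so the dilation estimate
      is applied to \<open>F\<close>, whose norm is already finite.\<close>
    define F where "F = (\<lambda>t. complex_of_real (enn2real (rearr L f (2 * t))))"
    have Fn: "ri_norm L \<rho> F = ext_rho L \<rho> (\<lambda>t. rearr L f (2 * t))"
      unfolding F_def by (rule ri_norm_rearr_dil[OF ri fm rfin]) auto
    have Fs: "F \<in> ri_space L \<rho>"
      using 2 Fn rearr_dil_meas_funs[of 2 L f] by (simp add: ri_space_def F_def)
    \<comment> \<open>\<open>F\<close> is its own rearrangement at t/2, a point of (0,L), and its
      value there is f^*(t).\<close>
    have "rearr L f t = rearr L F (1 / 2 * t)" if t: "t \<in> intv L" for t
    proof -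
      have "1 / 2 * t \<in> intv L"
        using t by (auto simp: intv_def intro: le_less_trans[rotated] ennreal_leI)
      then show ?thesis
        using rearr_rearr_dil[OF fm rfin, of 2 "1 / 2 * t"] by (simp add: F_def)
    qed
    then have "ri_norm L \<rho> f = ext_rho L \<rho> (\<lambda>t. rearr L F (1 / 2 * t))"
      unfolding ri_norm_def
      by (intro ext_rho_cong[OF ri] borel_lebesgue_on borel_ennreal_antimono rearr_antimono)
    also have "\<dots> \<le> dilation_norm L \<rho> (1 / 2) * ri_norm L \<rho> F"
      by (rule ext_rho_rearr_dil[OF ri L Fs]) simp
    also have "\<dots> \<le> ennreal (c * (1 / 2) powr (- e)) * (ennreal K * ext_rho L \<rho> (G f))"
      unfolding Fn using 1 dil[of "1 / 2"] by (intro mult_mono) auto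
    also have "\<dots> = ennreal (c * (1 / 2) powr (- e) * K) * ext_rho L \<rho> (G f)"
      using c K by (simp add: ennreal_mult mult.assoc)
    finally show "ri_norm L \<rho> f \<le> ennreal (c * (1 / 2) powr (- e) * K) *
        interp_norm L \<rho> \<Theta> r ?X0 ?N0 ?X1 ?N1 f"
      unfolding GN .
  qed
qed

theorem theorem15:
  fixes L p0 p1 q0 q1 :: ennreal
    and \<rho> :: "(real \<Rightarrow> complex) \<Rightarrow> ennreal"
    and \<Theta> :: real
  assumes "L = 1 \<or> L = \<infinity>"
    and "ri_quasi_Banach_function_space L \<rho>"
    and "0 < p0" and "p0 < p1" and "0 < q0" and "0 < q1"
    and "p0 < lower_Boyd L \<rho>"
    and "(upper_Boyd L \<rho> < p1 \<and> p1 < \<infinity> \<and> 1 / \<Theta> = recip p0 - recip p1) \<or>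
         (p1 = \<infinity> \<and> q1 = \<infinity> \<and> upper_Boyd L \<rho> \<le> \<infinity> \<and> \<Theta> = enn2real p0)"
  shows "interp_space L \<rho> \<Theta> (enn2real p0)
           (lorentz_space L p0 q0) (lorentz_norm L p0 q0)
           (lorentz_space L p1 q1) (lorentz_norm L p1 q1) = ri_space L \<rho> \<and>
         equiv_quasinorms (ri_space L \<rho>) (ri_norm L \<rho>)
           (interp_norm L \<rho> \<Theta> (enn2real p0)
             (lorentz_space L p0 q0) (lorentz_norm L p0 q0)
             (lorentz_space L p1 q1) (lorentz_norm L p1 q1))"
proof -
  note ri = assms(2)
  have L: "0 < L" and p1: "0 < p1" using assms by auto
  \<comment> \<open>\<open>p0\<close> is finite because p0 < p1, so \<open>enn2real\<close> does not
    take its default value 0.\<close>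
  have r: "1 / enn2real p0 = recip p0"
    using assms(3,4) by (cases p0) (auto simp: recip_ennreal)
  \<comment> \<open>In case (ii) the reciprocal of \<open>p1\<close> is 0, so \<Theta> = p0 obeys
    the formula of case (i), and the cases share the rest of the proof.\<close>
  have \<Theta>: "1 / \<Theta> = recip p0 - recip p1"
    and cases: "p1 = \<infinity> \<and> q1 = \<infinity> \<or> upper_Boyd L \<rho> < p1 \<and> p1 < \<infinity>"
    using assms(8) r by auto
  let ?I = "interp_space L \<rho> \<Theta> (enn2real p0)
    (lorentz_space L p0 q0) (lorentz_norm L p0 q0) (lorentz_space L p1 q1) (lorentz_norm L p1 q1)"
  let ?N = "interp_norm L \<rho> \<Theta> (enn2real p0)
    (lorentz_space L p0 q0) (lorentz_norm L p0 q0) (lorentz_space L p1 q1) (lorentz_norm L p1 q1)"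
  obtain M where M: "0 < M"
    and sum: "\<And>f. f \<in> ri_space L \<rho> \<Longrightarrow> f \<in> sum_space L (lorentz_space L p0 q0) (lorentz_space L p1 q1)"
    and upper: "\<And>f. f \<in> ri_space L \<rho> \<Longrightarrow> ?N f \<le> ennreal M * ri_norm L \<rho> f"
    using interp_norm_le_ri_norm[OF ri L assms(3,7,5) p1 cases assms(6) \<Theta> r] by blast
  obtain M' where M': "0 < M'" and lower: "\<And>f. f \<in> ?I \<Longrightarrow> ri_norm L \<rho> f \<le> ennreal M' * ?N f"
    using ri_norm_le_interp_norm[OF ri L assms(3,7,5,6) \<Theta> r] by blast
  have eq: "?I = ri_space L \<rho>"
  proof (intro set_eqI iffI)
    fix f assume f: "f \<in> ri_space L \<rho>"
    then have "?N f < \<infinity>"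
      using upper[OF f] by (auto simp: ri_space_def ennreal_mult_less_top elim!: le_less_trans)
    then show "f \<in> ?I" using sum[OF f] by (simp add: interp_space_def)
  next
    fix f assume f: "f \<in> ?I"
    then have "ri_norm L \<rho> f < \<infinity>"
      using lower[OF f] by (auto simp: interp_space_def ennreal_mult_less_top elim!: le_less_trans)
    then show "f \<in> ri_space L \<rho>"
      using f by (simp add: ri_space_def interp_space_def sum_space_def)
  qed
  \<comment> \<open>Equality of the two spaces makes \<open>lower\<close> applicable to every
    element of E; its constant is inverted.\<close>
  have "ennreal (1 / M') * ri_norm L \<rho> f \<le> ?N f" if f: "f \<in> ri_space L \<rho>" for f
  proof -
    have "ennreal (1 / M') * ri_norm L \<rho> f \<le> ennreal (1 / M') * (ennreal M' * ?N f)"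
      using lower[of f] f eq by (intro mult_left_mono) auto
    also have "\<dots> = ?N f"
      using M' by (simp add: mult.assoc[symmetric] flip: ennreal_mult)
    finally show ?thesis .
  qed
  then have "equiv_quasinorms (ri_space L \<rho>) (ri_norm L \<rho>) ?N"
    unfolding equiv_quasinorms_def using M M' upper
    by (intro exI[of _ "1 / M'"] exI[of _ M]) auto
  with eq show ?thesis by blast
qed

end
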